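(* Let $G$ be a graph and let $\mathcal{C}(G)$ be the set of all $2$-regular subgraphs of $G$. Then $$\phi(Q(G),x)=\beta(G,x)+\sum_{C\in\mathcal{C}(G)}(-2)^{\omega(C)}\beta(G,x)_{[G-C]},$$ and $$\beta(G,x)=\phi(Q(G),x)+\sum_{C\in\mathcal{C}(G)}2^{\omega(C)}\phi(Q(G)_{[G-C]},x).$$
   Context: All graphs are finite, undirected, without loops or multiple edges. $\omega(C)$ is the number of connected components of $C$. For a subgraph $C$, $G-C$ is the induced subgraph of $G$ on $V(G)\setminus V(C)$. $d_G(v)$ is the degree of $v$ in $G$; $\mathcal{M}(H)$ is the set of matchings of $H$ including the empty set; $V(M)$ is the set of endpoints of edges of $M$. For an induced subgraph $H$ of $G$, $\beta(G,x)_{[H]}=\sum_{M\in\mathcal{M}(H)}(-1)^{|M|}\prod_{v\in V(H)\setminus V(M)}(x-d_G(v))$ (degrees taken in $G$; equal to $1$ if $H$ is empty), and $\beta(G,x)=\beta(G,x)_{[G]}$ is the Laplacian matching polynomial. $Q(G)=D(G)+A(G)$ is the signless Laplacian matrix (degree diagonal matrix plus adjacency matrix), $Q(G)_{[G-C]}$ is its principal submatrix indexed by $V(G)\setminus V(C)$, and $\phi(M,x)=\det(xI-M)$ (equal to $1$ for the empty matrix). *)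

theory Defs
  imports
    "Jordan_Normal_Form.Char_Poly"
    "Jordan_Normal_Form.DL_Submatrix"
    "HOL-Library.Disjoint_Sets"
begin

datatype 'a graph = Graph (verts: "'a set") (edges: "'a set set")

definition simple_graph :: "'a graph \<Rightarrow> bool" where
  "simple_graph G \<longleftrightarrow> finite (verts G) \<and> (\<forall>e\<in>edges G. e \<subseteq> verts G \<and> card e = 2)"

definition subgraph :: "'a graph \<Rightarrow> 'a graph \<Rightarrow> bool" where
  "subgraph H G \<longleftrightarrow> simple_graph H \<and> verts H \<subseteq> verts G \<and> edges H \<subseteq> edges G"

definition induced_subgraph :: "'a graph \<Rightarrow> 'a set \<Rightarrow> 'a graph" where
  "induced_subgraph G W = Graph (verts G \<inter> W) {e \<in> edges G. e \<subseteq> W}"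

definition graph_diff :: "'a graph \<Rightarrow> 'a graph \<Rightarrow> 'a graph" where
  "graph_diff G C = induced_subgraph G (verts G - verts C)"

definition vdegree :: "'a graph \<Rightarrow> 'a \<Rightarrow> nat" where
  "vdegree G v = card {e \<in> edges G. v \<in> e}"

definition regular_graph :: "nat \<Rightarrow> 'a graph \<Rightarrow> bool" where
  "regular_graph k G \<longleftrightarrow> (\<forall>v\<in>verts G. vdegree G v = k)"

definition connected_components :: "'a graph \<Rightarrow> 'a set set" where
  "connected_components G = verts G // {(u, v). {u, v} \<in> edges G}\<^sup>*"

definition num_components :: "'a graph \<Rightarrow> nat" where
  "num_components G = card (connected_components G)"

(* The graph without vertices is vacuously regular of every degree; it has to be
   excluded here because both identities list its contribution separately. *)
definition two_regular_subgraphs :: "'a graph \<Rightarrow> 'a graph set" where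
  "two_regular_subgraphs G = {C. subgraph C G \<and> verts C \<noteq> {} \<and> regular_graph 2 C}"

definition matchings :: "'a graph \<Rightarrow> 'a set set set" where
  "matchings H = {M. M \<subseteq> edges H \<and> disjoint M}"

(* The vertex degrees are those in G, not those in H. *)
definition laplacian_matching_poly_on :: "'a graph \<Rightarrow> 'a graph \<Rightarrow> real poly" where
  "laplacian_matching_poly_on G H =
     (\<Sum>M\<in>matchings H. (- 1) ^ card M * (\<Prod>v\<in>verts H - \<Union>M. [:- real (vdegree G v), 1:]))"

definition laplacian_matching_poly :: "'a graph \<Rightarrow> real poly" where
  "laplacian_matching_poly G = laplacian_matching_poly_on G G"

(* Matrices of the library are indexed by natural numbers, so the matrices of a graph are
   taken with respect to an enumeration vs of its vertices. *)
definition degree_matrix :: "'a list \<Rightarrow> 'a graph \<Rightarrow> real mat" where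
  "degree_matrix vs G = mat (length vs) (length vs)
     (\<lambda>(i, j). if i = j then real (vdegree G (vs ! i)) else 0)"

definition adjacency_matrix :: "'a list \<Rightarrow> 'a graph \<Rightarrow> real mat" where
  "adjacency_matrix vs G = mat (length vs) (length vs)
     (\<lambda>(i, j). if {vs ! i, vs ! j} \<in> edges G then 1 else 0)"

definition signless_laplacian :: "'a list \<Rightarrow> 'a graph \<Rightarrow> real mat" where
  "signless_laplacian vs G = degree_matrix vs G + adjacency_matrix vs G"

definition principal_submatrix :: "'a list \<Rightarrow> real mat \<Rightarrow> 'a set \<Rightarrow> real mat" where
  "principal_submatrix vs A W =
     submatrix A {i. i < length vs \<and> vs ! i \<in> W} {i. i < length vs \<and> vs ! i \<in> W}"

end

(* Expand det (x I - Q) over the permutations of the vertices. A permutation with a nonzero term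
   consists of fixed points, transpositions along the edges of a matching, and cycles of length at
   least three along edges of G, i.e. an orientation of every component of a 2-regular subgraph C.
   Such a C has 2^omega(C) orientations, and as the sign of a permutation of S is (-1)^|S| times
   (-1) to the number of its cycles, each long cycle contributes a factor -1; this is the first
   identity. It says phi = c * beta, where * is the convolution of set functions and c(L) is the
   sum of (-2)^omega(C) over the 2-regular C with vertex set L. The inverse of c is
   d(L), the sum of 2^omega(C): in terms of permutations, (c * d)(S) runs over a permutation
   of S and a set of its cycles, and toggling one fixed cycle reverses the sign. *)

theory Submission
  imports Defs "HOL-Combinatorics.Cycles" "HOL-Combinatorics.Orbits"
begin

section \<open>Components and signs of permutations\<close>

text \<open>Sums over 2-regular subgraphs are treated as sums over permutations grouped by their
  \<open>permutation_graph\<close>, so both the expansion of the determinant and the cancellation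
  take place among permutations. Cycles are not separate objects there: their number is
  \<open>num_components (permutation_graph S p)\<close>, where a fixed point v is a component of its
  own with the degenerate edge {v}.

  The second identity does not follow from the first one for G alone. Inverting a convolution
  requires the first identity for every vertex set W, with degrees still taken in G; hence
  \<open>perm_expansion G W\<close>, whose weights do not depend on W. In permutation form, c(L) is
  the sum of (-1)^(number of cycles) over the permutations of L along edges with long cycles only,
  and d(L) is the number of these permutations.

  The count 2^omega(C) presupposes one orientation of an abstractly given 2-regular graph. It comes
  from an extremal argument on directed edges instead of a decomposition of C into cycles; the
  remaining orientations are then compared with this one.\<close>

definition permutation_graph :: "'a set \<Rightarrow> ('a \<Rightarrow> 'a) \<Rightarrow> 'a graph" where
  "permutation_graph S p = Graph S ((\<lambda>v. {v, p v}) ` S)"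

lemma verts_permutation_graph [simp]: "verts (permutation_graph S p) = S"
  and edges_permutation_graph [simp]: "edges (permutation_graph S p) = (\<lambda>v. {v, p v}) ` S"
  by (simp_all add: permutation_graph_def)

lemma connected_components_empty [simp]: "verts C = {} \<Longrightarrow> connected_components C = {}"
  by (simp add: connected_components_def)

lemma finite_connected_components: "finite (verts C) \<Longrightarrow> finite (connected_components C)"
  by (simp add: connected_components_def quotient_def)

text \<open>A set V that R cannot leave determines what is reachable from its points, so a component
  of a union of two graphs can be computed inside one of them.\<close>

lemma rtrancl_Image_separated:
  assumes "\<And>x y. x \<in> V \<Longrightarrow> (x, y) \<in> R \<Longrightarrow> (x, y) \<in> R' \<and> y \<in> V" and "R' \<subseteq> R" and "x \<in> V"
  shows "R\<^sup>* `` {x} = R'\<^sup>* `` {x}" and "R\<^sup>* `` {x} \<subseteq> V"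
proof -
  have *: "(x, y) \<in> R'\<^sup>* \<and> y \<in> V" if "(x, y) \<in> R\<^sup>*" for y
    using that
  proof (induction rule: rtrancl_induct)
    case base
    then show ?case using assms(3) by simp
  next
    case (step y z)
    then show ?case using assms(1)[of y z] by (meson rtrancl.rtrancl_into_rtrancl)
  qed
  then show "R\<^sup>* `` {x} = R'\<^sup>* `` {x}" "R\<^sup>* `` {x} \<subseteq> V"
    using rtrancl_mono[OF assms(2)] by auto
qed

text \<open>No edge joins the two vertex sets, so every reachability class of C is one of C1 or one
  of C2. Edges are only asked to lie inside their vertex set, because a permutation graph with fixed
  points is not a simple graph.\<close>

lemma num_components_disjoint_union:
  assumes "verts C = verts C1 \<union> verts C2" "edges C = edges C1 \<union> edges C2"
    and "verts C1 \<inter> verts C2 = {}"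
    and "\<Union>(edges C1) \<subseteq> verts C1" "\<Union>(edges C2) \<subseteq> verts C2"
    and "finite (verts C)"
  shows "num_components C = num_components C1 + num_components C2"
proof -
  let ?R = "\<lambda>C. {(u, v). {u, v} \<in> edges C}"
  have closed1: "{u, v} \<in> edges C1 \<and> v \<in> verts C1"
    if "u \<in> verts C1" "{u, v} \<in> edges C" for u v
  proof -
    have "{u, v} \<notin> edges C2"
    proof
      assume "{u, v} \<in> edges C2"
      then have "u \<in> verts C2" using assms(4,5) by auto
      then show False using that(1) assms(3) by auto
    qed
    then have "{u, v} \<in> edges C1" using that(2) assms(2) by simp
    then show ?thesis using assms(4,5) by auto
  qed
  have 1: "(?R C)\<^sup>* `` {x} = (?R C1)\<^sup>* `` {x}" "(?R C)\<^sup>* `` {x} \<subseteq> verts C1"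
    if "x \<in> verts C1" for x
    by (rule rtrancl_Image_separated[where V = "verts C1" and R' = "?R C1"];
        use closed1 assms(2) that in simp; auto)+
  have closed2: "{u, v} \<in> edges C2 \<and> v \<in> verts C2"
    if "u \<in> verts C2" "{u, v} \<in> edges C" for u v
  proof -
    have "{u, v} \<notin> edges C1"
    proof
      assume "{u, v} \<in> edges C1"
      then have "u \<in> verts C1" using assms(4,5) by auto
      then show False using that(1) assms(3) by auto
    qed
    then have "{u, v} \<in> edges C2" using that(2) assms(2) by simp
    then show ?thesis using assms(4,5) by auto
  qed
  have 2: "(?R C)\<^sup>* `` {x} = (?R C2)\<^sup>* `` {x}" "(?R C)\<^sup>* `` {x} \<subseteq> verts C2"
    if "x \<in> verts C2" for x
    by (rule rtrancl_Image_separated[where V = "verts C2" and R' = "?R C2"];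
        use closed2 assms(2) that in simp; auto)+
  have "connected_components C = connected_components C1 \<union> connected_components C2"
    unfolding connected_components_def quotient_def assms(1) using 1(1) 2(1) by auto
  moreover have "connected_components C1 \<inter> connected_components C2 = {}"
  proof -
    have "K \<subseteq> verts C1 \<and> K \<noteq> {}" if "K \<in> connected_components C1" for K
      using that 1 unfolding connected_components_def quotient_def by auto
    moreover have "K \<subseteq> verts C2" if "K \<in> connected_components C2" for K
      using that 2 unfolding connected_components_def quotient_def by auto
    ultimately show ?thesis using assms(3) by blast
  qed
  ultimately show ?thesis
    using assms(1,6) by (simp add: num_components_def card_Un_disjoint finite_connected_components)
qed

lemma num_components_transitive:
  assumes "x \<in> S" "p ` S \<subseteq> S" "\<And>u. u \<in> S \<Longrightarrow> \<exists>n. u = (p ^^ n) x"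
  shows "num_components (permutation_graph S p) = 1"
proof -
  let ?R = "{(u, v). {u, v} \<in> edges (permutation_graph S p)}"
  have S: "(p ^^ n) x \<in> S" for n
    by (induction n) (use assms in auto)
  have "(x, (p ^^ n) x) \<in> ?R\<^sup>*" for n
  proof (induction n)
    case (Suc n)
    have "((p ^^ n) x, (p ^^ Suc n) x) \<in> ?R"
      using S[of n] by auto
    then show ?case by (rule rtrancl_into_rtrancl[OF Suc])
  qed simp
  then have reach: "(x, u) \<in> ?R\<^sup>*" if "u \<in> S" for u
    using assms(3)[OF that] by blast
  \<comment> \<open>The iterates of \<open>p\<close> only give paths out of \<open>x\<close>;
    undirected edges supply the way back.\<close>
  have "sym (?R\<^sup>*)"
    by (rule sym_rtrancl) (auto simp: sym_def insert_commute)
  then have "(u, v) \<in> ?R\<^sup>*" if "u \<in> S" "v \<in> S" for u v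
    using reach that by (meson rtrancl_trans symD)
  moreover have "?R\<^sup>* `` {u} \<subseteq> S" if "u \<in> S" for u
    by (rule rtrancl_Image_separated(2)[where V = S and R' = ?R])
      (use assms(2) that in \<open>auto simp: doubleton_eq_iff\<close>)
  ultimately have "?R\<^sup>* `` {u} = S" if "u \<in> S" for u
    using that by blast
  then have "connected_components (permutation_graph S p) = {S}"
    using assms(1) unfolding connected_components_def quotient_def by auto
  then show ?thesis by (simp add: num_components_def)
qed

lemma num_components_cycle_of_list:
  assumes "cycle cs" "cs \<noteq> []"
  shows "num_components (permutation_graph (set cs) (cycle_of_list cs)) = 1"
proof (rule num_components_transitive)
  show "hd cs \<in> set cs" using assms by simp
  show "cycle_of_list cs ` set cs \<subseteq> set cs"
    using permutes_image[OF cycle_permutes[of cs]] by simp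
next
  fix u assume "u \<in> set cs"
  then obtain n where n: "n < length cs" "u = cs ! n" by (auto simp: in_set_conv_nth)
  have "map (cycle_of_list cs ^^ n) cs = rotate n cs" by (rule cyclic_rotation[OF assms(1)])
  then have "hd (map (cycle_of_list cs ^^ n) cs) = hd (rotate n cs)" by simp
  then show "\<exists>n. u = (cycle_of_list cs ^^ n) (hd cs)"
    using n assms(2) by (intro exI[of _ n]) (simp add: hd_map hd_rotate_conv_nth)
qed

text \<open>A cycle of length k is a product of k - 1 transpositions; the form - (-1)^k avoids a
  subtraction in the exponent.\<close>

lemma sign_cycle_of_list:
  "cycle cs \<Longrightarrow> cs \<noteq> [] \<Longrightarrow> sign (cycle_of_list cs) = - ((- 1) ^ length cs)"
proof (induction cs rule: cycle_of_list.induct)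
  case (1 i j cs)
  then show ?case
    unfolding cycle_of_list.simps sign_compose[OF permutation_swap_id permutation_of_cycle]
    by (simp add: sign_swap_id)
qed auto

lemma cycle_decomp_imp_permutes: "cycle_decomp S p \<Longrightarrow> p permutes S"
proof (induction rule: cycle_decomp.induct)
  case (comp I p cs)
  then show ?case
    using permutes_subset[OF cycle_permutes[of cs]] permutes_subset[of p I]
    by (intro permutes_compose) auto
qed (rule permutes_id)

text \<open>Induction over a cycle decomposition: attaching a cycle of length k multiplies the left
  side by (-1)^(k-1) * (-1)^k = -1, whatever k is, and adds one component. Fixed points count as
  components.\<close>

lemma sign_conv_num_components:
  assumes "p permutes S" "finite S"
  shows "sign p * (- 1) ^ card S = (- 1) ^ num_components (permutation_graph S p)"
  using cycle_decomposition[OF assms] assms(2)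
proof (induction rule: cycle_decomp.induct)
  case empty
  then show ?case by (simp add: num_components_def)
next
  case (comp I p cs)
  show ?case
  \<comment> \<open>\<open>cycle\<close> only asks for distinctness, so the rule may attach the
    empty list, which adds no component.\<close>
  proof (cases "cs = []")
    case True
    then show ?thesis using comp by simp
  next
    case False
    have p: "p permutes I" by (rule cycle_decomp_imp_permutes[OF comp(1)])
    have fin: "finite I" using comp by simp
    have eq1: "(cycle_of_list cs \<circ> p) x = cycle_of_list cs x" if "x \<in> set cs" for x
      using that comp(3) permutes_not_in[OF p] by force
    have eq2: "(cycle_of_list cs \<circ> p) x = p x" if "x \<in> I" for x
      using that comp(3) permutes_in_image[OF p] by (auto intro!: id_outside_supp)
    have "num_components (permutation_graph (set cs \<union> I) (cycle_of_list cs \<circ> p))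
        = num_components (permutation_graph (set cs) (cycle_of_list cs))
          + num_components (permutation_graph I p)"
      using comp(3) permutes_in_image[OF p] permutes_in_image[OF cycle_permutes[of cs]] eq1 eq2
      by (intro num_components_disjoint_union) (auto simp: image_Un fin)
    moreover have "card (set cs \<union> I) = length cs + card I"
      using comp fin by (simp add: card_Un_disjoint distinct_card)
    moreover have "sign (cycle_of_list cs \<circ> p) = sign (cycle_of_list cs) * sign p"
    proof (intro sign_compose permutation_of_cycle)
      show "permutation p" unfolding permutation_permutes using p fin by blast
    qed
    moreover have "sign (cycle_of_list cs) * (- 1) ^ length cs = - 1"
      using sign_cycle_of_list[OF comp(2) False]
      by (simp flip: power_mult_distrib power_add)
    moreover note comp.IH[OF fin] num_components_cycle_of_list[OF comp(2) False]
    moreover have "sign (cycle_of_list cs) * sign p * (- 1) ^ (length cs + card I)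
        = (sign (cycle_of_list cs) * (- 1) ^ length cs) * (sign p * (- 1) ^ card I)"
      by (simp add: power_add)
    ultimately show ?thesis
      by (simp only: power_add power_one_right)
  qed
qed

section \<open>Splitting a permutation along an invariant set\<close>

lemma perm_restrict_permutes_invariant:
  assumes "p permutes W" "p ` T = T" "finite T"
  shows "perm_restrict p T permutes T"
proof (rule bij_imp_permutes)
  have "inj_on p T" using permutes_inj_on[OF assms(1)] by blast
  then show "bij_betw (perm_restrict p T) T T"
    using assms(2) by (auto simp: bij_betw_def inj_on_def perm_restrict_def)
qed (simp add: perm_restrict_def)

lemma permutes_comp_disjoint:
  assumes "r permutes T" "q permutes U" "T \<inter> U = {}"
  shows "x \<in> T \<Longrightarrow> (r \<circ> q) x = r x" and "x \<in> U \<Longrightarrow> (r \<circ> q) x = q x"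
proof -
  show "(r \<circ> q) x = r x" if "x \<in> T"
  proof -
    have "x \<notin> U" using that assms(3) by blast
    then show ?thesis using permutes_not_in[OF assms(2)] by simp
  qed
  show "(r \<circ> q) x = q x" if "x \<in> U"
  proof -
    have "q x \<notin> T" using permutes_in_image[OF assms(2), of x] that assms(3) by auto
    then show ?thesis using permutes_not_in[OF assms(1)] by simp
  qed
qed

text \<open>A permutation preserving T amounts to an independent choice of a permutation of T and
  one of the rest. T will be a union of selected cycles, or the union of all cycles of length at
  least three.\<close>

lemma sum_permutes_invariant:
  assumes "finite W" "T \<subseteq> W"
  shows "(\<Sum>p | p permutes W \<and> p ` T = T. f p)
    = (\<Sum>r | r permutes T. \<Sum>q | q permutes W - T. f (r \<circ> q))"
proof -
  have fin: "finite T" "finite (W - T)" using assms finite_subset by auto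
  have "(\<Sum>p | p permutes W \<and> p ` T = T. f p)
      = (\<Sum>(r, q) \<in> {r. r permutes T} \<times> {q. q permutes W - T}. f (r \<circ> q))"
  proof (rule sum.reindex_bij_witness[where
        i = "\<lambda>(r, q). r \<circ> q" and j = "\<lambda>p. (perm_restrict p T, perm_restrict p (W - T))"])
    fix p assume "p \<in> {p. p permutes W \<and> p ` T = T}"
    then have p: "p permutes W" "p ` T = T" by auto
    have p': "p ` (W - T) = W - T"
      using p image_set_diff[OF permutes_inj[OF p(1)], of W T] by (simp add: permutes_image)
    have "perm_restrict p T \<circ> perm_restrict p (W - T) = p"
      using p' p by (auto simp: fun_eq_iff perm_restrict_def permutes_not_in)
    then show "(case (perm_restrict p T, perm_restrict p (W - T)) of (r, q) \<Rightarrow> r \<circ> q) = p"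
      and "(case (perm_restrict p T, perm_restrict p (W - T)) of (r, q) \<Rightarrow> f (r \<circ> q)) = f p"
      by simp_all
    show "(perm_restrict p T, perm_restrict p (W - T))
        \<in> {r. r permutes T} \<times> {q. q permutes W - T}"
      using perm_restrict_permutes_invariant[OF p(1)] p p' fin by simp
  next
    fix b assume "b \<in> {r. r permutes T} \<times> {q. q permutes W - T}"
    then obtain r q where b: "b = (r, q)" and r: "r permutes T" and q: "q permutes W - T" by auto
    have rq: "x \<in> T \<Longrightarrow> (r \<circ> q) x = r x" "x \<in> W - T \<Longrightarrow> (r \<circ> q) x = q x" for x
      using permutes_comp_disjoint[OF r q] by auto
    have "(r \<circ> q) permutes W"
      using assms(2) permutes_subset[OF r] permutes_subset[OF q] by (intro permutes_compose) auto
    moreover have "(r \<circ> q) ` T = T"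
      using permutes_image[OF r] rq by simp
    ultimately show "(case b of (r, q) \<Rightarrow> r \<circ> q) \<in> {p. p permutes W \<and> p ` T = T}"
      by (simp add: b)
    have "perm_restrict (r \<circ> q) T = r" "perm_restrict (r \<circ> q) (W - T) = q"
      using r q rq by (auto simp: fun_eq_iff perm_restrict_def permutes_not_in)
    then show "(perm_restrict (case b of (r, q) \<Rightarrow> r \<circ> q) T,
        perm_restrict (case b of (r, q) \<Rightarrow> r \<circ> q) (W - T)) = b"
      by (simp add: b)
  qed
  then show ?thesis by (simp add: sum.cartesian_product)
qed

section \<open>Orientations of 2-regular graphs\<close>

text \<open>The condition \<open>r (r v) \<noteq> v\<close> rules out fixed points and
  transpositions at once, so every cycle has length at least three.\<close>

definition long_permutations :: "'a set set \<Rightarrow> 'a set \<Rightarrow> ('a \<Rightarrow> 'a) set" where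
  "long_permutations E L = {r. r permutes L \<and> (\<forall>v\<in>L. {v, r v} \<in> E \<and> r (r v) \<noteq> v)}"

lemma simple_graph_edgeD:
  assumes "simple_graph G" "{u, v} \<in> edges G"
  shows "u \<noteq> v" "u \<in> verts G" "v \<in> verts G"
proof -
  have "card {u, v} = 2" "{u, v} \<subseteq> verts G"
    using assms unfolding simple_graph_def by auto
  then show "u \<noteq> v" "u \<in> verts G" "v \<in> verts G" by (auto simp: card_2_iff)
qed

lemma vdegree_conv_neighbors:
  assumes "simple_graph G"
  shows "vdegree G v = card {w. {v, w} \<in> edges G}"
proof -
  have "bij_betw (\<lambda>w. {v, w}) {w. {v, w} \<in> edges G} {e \<in> edges G. v \<in> e}"
  proof (rule bij_betwI')
    fix e assume "e \<in> {e \<in> edges G. v \<in> e}"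
    then have e: "e \<in> edges G" "v \<in> e" "card e = 2"
      using assms by (auto simp: simple_graph_def)
    then obtain w where "e = {v, w}" by (auto simp: card_2_iff)
    with e show "\<exists>w\<in>{w. {v, w} \<in> edges G}. e = {v, w}" by auto
  qed (auto simp: doubleton_eq_iff)
  then show ?thesis unfolding vdegree_def by (rule bij_betw_same_card[symmetric])
qed

locale two_regular =
  fixes C :: "'a graph"
  assumes simple: "simple_graph C" and regular: "regular_graph 2 C"
begin

abbreviation neighbors :: "'a \<Rightarrow> 'a set" where
  "neighbors v \<equiv> {w. {v, w} \<in> edges C}"

lemma finite_verts: "finite (verts C)"
  using simple by (simp add: simple_graph_def)

lemma card_neighbors: "v \<in> verts C \<Longrightarrow> card (neighbors v) = 2"
  using regular vdegree_conv_neighbors[OF simple, of v] by (simp add: regular_graph_def)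

lemma neighbor_unique:
  assumes "v \<in> verts C" "{a, b, c} \<subseteq> neighbors v" "a \<noteq> c" "b \<noteq> c"
  shows "a = b"
proof -
  obtain x y where "neighbors v = {x, y}"
    using card_neighbors[OF assms(1)] by (auto simp: card_2_iff)
  then have "{a, b, c} \<subseteq> {x, y}" using assms(2) by simp
  then show ?thesis using assms(3,4) by auto
qed

text \<open>A dart is an edge with a direction, and this is one step of the walk that never turns
  back. In degree 2 the choice has exactly one candidate for each dart, so the walk is
  determined.\<close>

definition next_dart :: "'a \<times> 'a \<Rightarrow> 'a \<times> 'a" where
  "next_dart d = (snd d, SOME w. w \<in> neighbors (snd d) \<and> w \<noteq> fst d)"

definition darts :: "('a \<times> 'a) set" where
  "darts = {(u, v). {u, v} \<in> edges C}"

lemma finite_darts: "finite darts"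
  by (rule finite_subset[of _ "verts C \<times> verts C"])
    (use simple_graph_edgeD[OF simple] finite_verts in \<open>auto simp: darts_def\<close>)

lemma swap_in_darts: "prod.swap d \<in> darts \<longleftrightarrow> d \<in> darts"
  by (auto simp: darts_def insert_commute)

lemma next_dart:
  assumes "(u, v) \<in> darts"
  obtains w where "next_dart (u, v) = (v, w)" "(v, w) \<in> darts" "w \<noteq> u"
proof -
  have "v \<in> verts C" using assms simple_graph_edgeD[OF simple] by (auto simp: darts_def)
  then have "\<exists>w. w \<in> neighbors v \<and> w \<noteq> u"
    using card_neighbors[of v] by (auto simp: card_2_iff)
  then have "(SOME w. w \<in> neighbors v \<and> w \<noteq> u) \<in> neighbors v
      \<and> (SOME w. w \<in> neighbors v \<and> w \<noteq> u) \<noteq> u"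
    by (rule someI_ex)
  then show ?thesis by (intro that) (auto simp: next_dart_def darts_def)
qed

lemma next_dart_in_darts: "d \<in> darts \<Longrightarrow> next_dart d \<in> darts"
  by (cases d) (metis next_dart)

lemma next_dart_eqI:
  assumes "(u, v) \<in> darts" "(v, w) \<in> darts" "w \<noteq> u"
  shows "next_dart (u, v) = (v, w)"
proof -
  obtain w' where w': "next_dart (u, v) = (v, w')" "(v, w') \<in> darts" "w' \<noteq> u"
    using next_dart[OF assms(1)] by blast
  have "w' = w"
    by (rule neighbor_unique[of v w' w u])
      (use assms w' simple_graph_edgeD[OF simple] in \<open>auto simp: darts_def insert_commute\<close>)
  with w' show ?thesis by simp
qed

text \<open>Reversing darts turns the walk into its inverse, since the vertex left behind is the
  only continuation backwards. Injectivity of the walk follows.\<close>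

lemma next_dart_swap: "d \<in> darts \<Longrightarrow> next_dart (prod.swap (next_dart d)) = prod.swap d"
proof (cases d)
  case (Pair u v)
  assume "d \<in> darts"
  then obtain w where w: "next_dart (u, v) = (v, w)" "(v, w) \<in> darts" "w \<noteq> u"
    using next_dart Pair by blast
  have "next_dart (w, v) = (v, u)"
    using w \<open>d \<in> darts\<close> swap_in_darts[of "(v, w)"] swap_in_darts[of "(u, v)"] Pair
    by (intro next_dart_eqI) auto
  with w Pair show ?thesis by simp
qed

lemma next_dart_inj: "d \<in> darts \<Longrightarrow> d' \<in> darts \<Longrightarrow> next_dart d = next_dart d' \<Longrightarrow> d = d'"
  by (metis next_dart_swap swap_swap)

lemma funpow_next_dart_in_darts: "d \<in> darts \<Longrightarrow> (next_dart ^^ k) d \<in> darts"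
  by (induction k) (auto intro: next_dart_in_darts)

lemma funpow_next_dart_swap:
  "d \<in> darts \<Longrightarrow> (next_dart ^^ k) (prod.swap ((next_dart ^^ k) d)) = prod.swap d"
proof (induction k arbitrary: d)
  case (Suc k)
  have "(next_dart ^^ Suc k) (prod.swap ((next_dart ^^ Suc k) d))
      = next_dart ((next_dart ^^ k) (prod.swap ((next_dart ^^ k) (next_dart d))))"
    by (simp add: funpow_swap1)
  then show ?case
    using Suc by (simp add: next_dart_in_darts next_dart_swap del: funpow.simps)
qed simp

text \<open>A walk from d to its reversal can be shortened at both ends: dropping the first and the
  last step leaves a walk of length k - 2 from \<open>next_dart d\<close> to its reversal. This
  descends to k = 0, which would be a loop, or k = 1, which would be a turn back.\<close>

lemma funpow_next_dart_neq_swap: "d \<in> darts \<Longrightarrow> (next_dart ^^ k) d \<noteq> prod.swap d"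
proof (induction k arbitrary: d rule: less_induct)
  case (less k)
  obtain u v where d: "d = (u, v)" by (cases d)
  obtain w where w: "next_dart (u, v) = (v, w)" "(v, w) \<in> darts" "w \<noteq> u"
    using next_dart less.prems d by blast
  have "u \<noteq> v" using less.prems simple_graph_edgeD[OF simple] by (auto simp: d darts_def)
  consider "k = 0" | "k = 1" | j where "k = Suc (Suc j)"
    by (metis One_nat_def not0_implies_Suc)
  then show ?case
  proof cases
    case 3
    let ?e = "next_dart d"
    have e: "?e \<in> darts" by (rule next_dart_in_darts[OF less.prems])
    have "(next_dart ^^ k) d = next_dart ((next_dart ^^ j) ?e)"
      using 3 by (simp add: funpow_swap1)
    moreover have "prod.swap d = next_dart (prod.swap ?e)"
      using next_dart_swap[OF less.prems] by simp
    moreover have "(next_dart ^^ j) ?e \<noteq> prod.swap ?e"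
      using less.IH[of j ?e] 3 e by simp
    ultimately show ?thesis
      using next_dart_inj[of "(next_dart ^^ j) ?e" "prod.swap ?e"]
        funpow_next_dart_in_darts[OF e] e swap_in_darts by metis
  qed (use d w \<open>u \<noteq> v\<close> in auto)
qed

text \<open>Walking along \<open>C\<close> from a dart never meets the reversed dart, so a maximal set of darts
  closed under walking and free of reversed pairs orients every edge.\<close>

lemma ex_dart_orientation:
  obtains D where "D \<subseteq> darts" "next_dart ` D \<subseteq> D" "D \<inter> prod.swap ` D = {}"
    "darts \<subseteq> D \<union> prod.swap ` D"
proof -
  define P where "P = (\<lambda>D. D \<subseteq> darts \<and> next_dart ` D \<subseteq> D \<and> D \<inter> prod.swap ` D = {})"
  have "P {}" by (simp add: P_def)
  moreover have "finite {D. P D}"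
    by (rule finite_subset[of _ "Pow darts"]) (use finite_darts in \<open>auto simp: P_def\<close>)
  ultimately obtain D where D: "P D" and max: "\<And>D'. P D' \<Longrightarrow> D \<subseteq> D' \<Longrightarrow> D' = D"
    using finite_has_maximal[of "{D. P D}"] by auto
  have pow: "(next_dart ^^ k) d \<in> D" if "d \<in> D" for k d
    using that D by (induction k) (auto simp: P_def)
  have "e \<in> D \<union> prod.swap ` D" if e: "e \<in> darts" for e
  proof (rule ccontr)
    assume "\<not> ?thesis"
    then have out: "e \<notin> D" "prod.swap e \<notin> D" by (auto simp: image_iff)
    \<comment> \<open>The whole forward orbit of the missing dart is added to \<open>D\<close>; it
      remains to see that no reversed pair arises.\<close>
    define Orb where "Orb = range (\<lambda>k. (next_dart ^^ k) e)"
    \<comment> \<open>Walking on from the reversal of an orbit dart retraces the orbit down to the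
      reversal of \<open>e\<close>; as \<open>D\<close> is closed under walking, it would contain
      that dart.\<close>
    have O_D: False if d: "d \<in> Orb" "prod.swap d \<in> D" for d
    proof -
      obtain k where k: "d = (next_dart ^^ k) e" using d unfolding Orb_def by blast
      have "(next_dart ^^ k) (prod.swap d) = prod.swap e"
        unfolding k by (rule funpow_next_dart_swap[OF e])
      then show False using pow[OF d(2)] out(2) by metis
    qed
    have O_O: False if d: "d \<in> Orb" "prod.swap d \<in> Orb" for d
    proof -
      obtain j k where "d = (next_dart ^^ j) e" "prod.swap d = (next_dart ^^ k) e"
        using d unfolding Orb_def by blast
      then have "(next_dart ^^ (j + k)) e = prod.swap e"
        using funpow_next_dart_swap[OF e, of j] by (simp add: funpow_add)
      then show False using funpow_next_dart_neq_swap[OF e] by blast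
    qed
    have "P (D \<union> Orb)"
      unfolding P_def
    proof (intro conjI)
      show "D \<union> Orb \<subseteq> darts" using D funpow_next_dart_in_darts[OF e] by (auto simp: P_def Orb_def)
      have "next_dart ((next_dart ^^ k) e) \<in> Orb" for k
        unfolding Orb_def by (rule range_eqI[of _ _ "Suc k"]) simp
      then show "next_dart ` (D \<union> Orb) \<subseteq> D \<union> Orb" using D by (auto simp: P_def Orb_def)
      have "prod.swap d \<notin> D \<union> Orb" if d: "d \<in> D \<union> Orb" for d
      proof
        assume "prod.swap d \<in> D \<union> Orb"
        then consider "d \<in> D" "prod.swap d \<in> D" | "d \<in> D" "prod.swap d \<in> Orb"
          | "d \<in> Orb" "prod.swap d \<in> D" | "d \<in> Orb" "prod.swap d \<in> Orb"
          using d by blast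
        then show False
        proof cases
          case 1
          then show ?thesis using D unfolding P_def by blast
        next
          case 2
          then show ?thesis using O_D[of "prod.swap d"] by simp
        next
          case 3
          then show ?thesis by (rule O_D)
        next
          case 4
          then show ?thesis by (rule O_O)
        qed
      qed
      then show "(D \<union> Orb) \<inter> prod.swap ` (D \<union> Orb) = {}" by blast
    qed
    then have "D \<union> Orb = D" by (rule max) simp
    moreover have "e \<in> Orb" unfolding Orb_def by (rule range_eqI[of _ _ 0]) simp
    ultimately show False using out(1) by blast
  qed
  then have "darts \<subseteq> D \<union> prod.swap ` D" by blast
  then show ?thesis using D that[of D] unfolding P_def by blast
qed

text \<open>Each vertex is sent to the head of a dart of D leaving it. Such a dart exists: with
  neighbours a and b, either the dart from a to v is in D and the walk continues to b, or its
  reversal already leaves v.\<close>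

lemma ex_long_permutation: "long_permutations (edges C) (verts C) \<noteq> {}"
proof -
  obtain D where D: "D \<subseteq> darts" "next_dart ` D \<subseteq> D" "D \<inter> prod.swap ` D = {}"
    "darts \<subseteq> D \<union> prod.swap ` D"
    using ex_dart_orientation by blast
  have asym: "(w, v) \<notin> D" if "(v, w) \<in> D" for v w
  proof
    assume "(w, v) \<in> D"
    moreover have "(w, v) \<in> prod.swap ` D" using that by (rule rev_image_eqI) simp
    ultimately show False using D(3) by blast
  qed
  have "\<exists>w. (v, w) \<in> D" if v: "v \<in> verts C" for v
  proof -
    obtain a b where ab: "neighbors v = {a, b}" "a \<noteq> b"
      using card_neighbors[OF v] by (auto simp: card_2_iff)
    then have "{v, a} \<in> edges C" "{v, b} \<in> edges C" by auto
    then have dart: "(a, v) \<in> darts" "(v, b) \<in> darts" by (auto simp: darts_def insert_commute)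
    show ?thesis
    proof (cases "(a, v) \<in> D")
      case True
      then have "next_dart (a, v) \<in> D" using D(2) by auto
      then show ?thesis using next_dart_eqI[OF dart] ab(2) by auto
    next
      case False
      then have "(a, v) \<in> prod.swap ` D" using D(4) dart(1) by blast
      then obtain d where "d \<in> D" "(a, v) = prod.swap d" by blast
      then show ?thesis by (cases d) auto
    qed
  qed
  then obtain f where f: "\<And>v. v \<in> verts C \<Longrightarrow> (v, f v) \<in> D" by metis
  define p where "p = perm_restrict f (verts C)"
  have p: "(v, p v) \<in> D" if "v \<in> verts C" for v
    using f that by (simp add: p_def perm_restrict_def)
  have edge: "{v, p v} \<in> edges C" if "v \<in> verts C" for v
    using p[OF that] D(1) by (auto simp: darts_def)
  have in_V: "p v \<in> verts C" if "v \<in> verts C" for v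
    using simple_graph_edgeD[OF simple edge[OF that]] by simp
  have "inj_on p (verts C)"
  \<comment> \<open>If two darts of \<open>D\<close> entered the same vertex, the walk continuing
    the first one would be the reversal of the second.\<close>
  proof (rule inj_onI, rule ccontr)
    fix u v assume uv: "u \<in> verts C" "v \<in> verts C" "p u = p v" "u \<noteq> v"
    have "(u, p u) \<in> darts" "(p u, v) \<in> darts"
      using edge[OF uv(1)] edge[OF uv(2)] uv(3) by (simp_all add: darts_def insert_commute)
    then have "next_dart (u, p u) = (p u, v)"
      using uv(4) by (intro next_dart_eqI) auto
    then have "(p u, v) \<in> D" using D(2) p[OF uv(1)] by (metis image_subset_iff)
    then show False using asym p[OF uv(2)] uv(3) by simp
  qed
  then have "p permutes verts C"
    using in_V by (intro inj_imp_permutes finite_verts) (auto simp: p_def perm_restrict_simps)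
  moreover have "p (p v) \<noteq> v" if "v \<in> verts C" for v
    using p[OF that] p[OF in_V[OF that]] asym by metis
  ultimately show ?thesis using edge by (auto simp: long_permutations_def)
qed

text \<open>Image and preimage of v are neighbours of v, distinct because
  \<open>p (p v) \<noteq> v\<close>, and degree 2 leaves no room for a third.\<close>

lemma long_permutation_neighbors:
  assumes p: "p \<in> long_permutations (edges C) (verts C)" and v: "v \<in> verts C"
  shows "neighbors v = {p v, inv_into UNIV p v}" "p v \<noteq> inv_into UNIV p v"
    "p v \<in> verts C" "inv_into UNIV p v \<in> verts C" "p (p v) \<noteq> v"
proof -
  have perm: "p permutes verts C" and edge: "\<And>u. u \<in> verts C \<Longrightarrow> {u, p u} \<in> edges C"
    and long: "\<And>u. u \<in> verts C \<Longrightarrow> p (p u) \<noteq> u"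
    using p by (auto simp: long_permutations_def)
  show pv: "p v \<in> verts C" and iv: "inv_into UNIV p v \<in> verts C" and "p (p v) \<noteq> v"
    using v permutes_in_image[OF perm] permutes_in_image[OF permutes_inv[OF perm]] long by auto
  show neq: "p v \<noteq> inv_into UNIV p v"
    using long[OF v] permutes_inverses(1)[OF perm, of v] by metis
  have "{v, p v} \<in> edges C" "{v, inv_into UNIV p v} \<in> edges C"
    using edge[OF v] edge[OF iv] permutes_inverses(1)[OF perm, of v]
    by (auto simp: insert_commute)
  then have "{p v, inv_into UNIV p v} = neighbors v"
    using card_neighbors[OF v] neq by (intro card_subset_eq card_ge_0_finite) auto
  then show "neighbors v = {p v, inv_into UNIV p v}" ..
qed

text \<open>No edge of C is missed: the other end of an edge at u is the image or the preimage of u.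
  Hence these permutations are orientations of all of C, not of a proper subgraph.\<close>

lemma permutation_graph_long_permutation:
  assumes "p \<in> long_permutations (edges C) (verts C)"
  shows "permutation_graph (verts C) p = C"
proof -
  have perm: "p permutes verts C" using assms by (auto simp: long_permutations_def)
  have "(\<lambda>v. {v, p v}) ` verts C = edges C"
  proof
    show "(\<lambda>v. {v, p v}) ` verts C \<subseteq> edges C" using assms by (auto simp: long_permutations_def)
  next
    show "edges C \<subseteq> (\<lambda>v. {v, p v}) ` verts C"
    proof
      fix e assume e: "e \<in> edges C"
      then obtain u v where uv: "e = {u, v}"
        using simple by (auto simp: simple_graph_def card_2_iff)
      have u: "u \<in> verts C" using simple_graph_edgeD[OF simple] e uv by blast
      have "v = p u \<or> v = inv_into UNIV p u"
        using long_permutation_neighbors(1)[OF assms u] e uv by auto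
      then show "e \<in> (\<lambda>v. {v, p v}) ` verts C"
      proof
        assume "v = inv_into UNIV p u"
        then have "e = {v, p v}" "v \<in> verts C"
          using uv permutes_inverses(1)[OF perm] long_permutation_neighbors(4)[OF assms u] by auto
        then show ?thesis by blast
      qed (use uv u in auto)
    qed
  qed
  then show ?thesis by (cases C) (simp add: permutation_graph_def)
qed

section \<open>Components of a 2-regular graph and the number of its orientations\<close>

lemma connected_component_eq:
  assumes "K \<in> connected_components C" "v \<in> K"
  shows "K = {(u, v). {u, v} \<in> edges C}\<^sup>* `` {v}" "v \<in> verts C"
proof -
  let ?R = "{(u, v). {u, v} \<in> edges C}"
  obtain x where x: "x \<in> verts C" "K = ?R\<^sup>* `` {x}"
    using assms(1) unfolding connected_components_def quotient_def by auto
  have sym: "sym (?R\<^sup>*)"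
    by (rule sym_rtrancl) (auto simp: sym_def insert_commute)
  have "(x, v) \<in> ?R\<^sup>*" using assms(2) x by simp
  then show "K = ?R\<^sup>* `` {v}"
    unfolding x(2) using sym by (auto dest: symD intro: rtrancl_trans)
  show "v \<in> verts C"
    using \<open>(x, v) \<in> ?R\<^sup>*\<close> x(1)
    by (induction rule: rtrancl_induct) (use simple_graph_edgeD[OF simple] in auto)
qed

lemma Union_connected_components: "\<Union>(connected_components C) = verts C"
proof
  show "\<Union>(connected_components C) \<subseteq> verts C" using connected_component_eq(2) by blast
  show "verts C \<subseteq> \<Union>(connected_components C)"
    unfolding connected_components_def quotient_def by auto
qed

lemma connected_component_edge:
  assumes "K \<in> connected_components C" "{u, v} \<in> edges C"
  shows "u \<in> K \<longleftrightarrow> v \<in> K"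
proof -
  have "v \<in> K" if "u \<in> K" "{u, v} \<in> edges C" for u v
    using connected_component_eq(1)[OF assms(1) that(1)] that(2) by auto
  from this[of u v] this[of v u] show ?thesis using assms(2) by (auto simp: insert_commute)
qed

lemma connected_component_subset:
  assumes "K \<in> connected_components C" "v \<in> K" "v \<in> A"
    and closed: "\<And>u w. u \<in> A \<Longrightarrow> {u, w} \<in> edges C \<Longrightarrow> w \<in> A"
  shows "K \<subseteq> A"
proof -
  have "w \<in> A" if "(v, w) \<in> {(u, v). {u, v} \<in> edges C}\<^sup>*" for w
    using that by (induction rule: rtrancl_induct) (use assms(3) closed in auto)
  then show ?thesis using connected_component_eq(1)[OF assms(1,2)] by auto
qed

text \<open>Equal images at v force equal preimages at v, both being the remaining neighbour. So p
  and q traverse the two edges at v in the same direction, which settles their values at either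
  neighbour. Agreement thus spreads over whole components.\<close>

lemma long_permutations_agreement_closed:
  assumes p: "p \<in> long_permutations (edges C) (verts C)"
    and q: "q \<in> long_permutations (edges C) (verts C)"
    and v: "v \<in> verts C" "p v = q v" "{v, u} \<in> edges C"
  shows "p u = q u"
proof -
  have perm: "p permutes verts C" "q permutes verts C"
    using p q by (auto simp: long_permutations_def)
  note np = long_permutation_neighbors[OF p] and nq = long_permutation_neighbors[OF q]
  have u: "u \<in> verts C" using simple_graph_edgeD[OF simple v(3)] by simp
  have inv_eq: "inv_into UNIV p v = inv_into UNIV q v"
    using np(1,2)[OF v(1)] nq(1,2)[OF v(1)] v(2) by (metis doubleton_eq_iff)
  consider "u = q v" | "u = inv_into UNIV q v"
    using nq(1)[OF v(1)] v(3) by blast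
  then show ?thesis
  proof cases
    case 1
    have "inv_into UNIV p u = v" "inv_into UNIV q u = v"
      using 1 v(2) permutes_inverses(2) perm by metis+
    then show ?thesis using np(1,2)[OF u] nq(1,2)[OF u] by (metis doubleton_eq_iff)
  next
    case 2
    then show ?thesis using inv_eq permutes_inverses(1) perm by metis
  qed
qed

text \<open>Relative to a fixed orientation of \<open>C\<close>, any other one is obtained by reversing a set of
  components.\<close>

lemma card_long_permutations:
  "card (long_permutations (edges C) (verts C)) = 2 ^ num_components C"
proof -
  let ?K = "connected_components C" and ?L = "long_permutations (edges C) (verts C)"
  obtain p where p: "p \<in> ?L" using ex_long_permutation by blast
  then have perm: "p permutes verts C" by (auto simp: long_permutations_def)
  note np = long_permutation_neighbors[OF p]
  \<comment> \<open>\<open>X\<close> is the set of components on which the direction of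
    \<open>p\<close> is kept; the others are reversed.\<close>
  define sel where "sel X v = (if v \<in> \<Union>X then p v else inv_into UNIV p v)" for X v
  have sel_nbr: "{v, sel X v} \<in> edges C" if "v \<in> verts C" for X v
    using np(1)[OF that] by (auto simp: sel_def)
  have part: "u \<in> \<Union>X \<longleftrightarrow> v \<in> \<Union>X" if "X \<subseteq> ?K" "{u, v} \<in> edges C" for X u v
    using connected_component_edge[OF _ that(2)] that(1) by blast
  have sel_long: "sel X \<in> ?L" if X: "X \<subseteq> ?K" for X
  proof -
    have sel_part: "sel X v \<in> \<Union>X \<longleftrightarrow> v \<in> \<Union>X" if "v \<in> verts C" for v
      using part[OF X sel_nbr[OF that]] by blast
    have "inj_on (sel X) (verts C)"
    proof (rule inj_onI)
      fix u v assume uv: "u \<in> verts C" "v \<in> verts C" "sel X u = sel X v"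
      then have "u \<in> \<Union>X \<longleftrightarrow> v \<in> \<Union>X" using sel_part by metis
      then show "u = v"
        using uv(3) permutes_inj[OF perm] permutes_inj[OF permutes_inv[OF perm]]
        by (auto simp: sel_def inj_eq split: if_splits)
    qed
    moreover have "sel X v \<in> verts C" if "v \<in> verts C" for v
      using np(3,4)[OF that] by (simp add: sel_def)
    moreover have "sel X v = v" if "v \<notin> verts C" for v
      using that permutes_not_in[OF perm] permutes_not_in[OF permutes_inv[OF perm]]
      by (simp add: sel_def)
    ultimately have "sel X permutes verts C"
      by (intro inj_imp_permutes finite_verts)
    moreover have "sel X (sel X v) \<noteq> v" if v: "v \<in> verts C" for v
    proof (cases "v \<in> \<Union>X")
      case True
      then show ?thesis using sel_part[OF v] np(5)[OF v] by (simp add: sel_def)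
    next
      case False
      then have "sel X (sel X v) = inv_into UNIV p (inv_into UNIV p v)"
        using sel_part[OF v] by (simp add: sel_def)
      moreover have "inv_into UNIV p (inv_into UNIV p v) \<noteq> v"
        using np(2)[OF v] permutes_inverses(1)[OF perm] by metis
      ultimately show ?thesis by simp
    qed
    ultimately show ?thesis using sel_nbr by (simp add: long_permutations_def)
  qed
  have "inj_on sel (Pow ?K)"
  proof (rule inj_onI)
    have sub: "X \<subseteq> Y" if XY: "X \<subseteq> ?K" "Y \<subseteq> ?K" "sel X = sel Y" for X Y
    proof
      fix K assume K: "K \<in> X"
      then obtain x where "x \<in> verts C" "K = {(u, v). {u, v} \<in> edges C}\<^sup>* `` {x}"
        using XY(1) unfolding connected_components_def quotient_def by auto
      then have x: "x \<in> K" "x \<in> verts C" by auto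
      then have "sel X x = p x" using K by (auto simp: sel_def)
      then have "sel Y x = p x" using XY(3) by simp
      \<comment> \<open>Outside the components of \<open>Y\<close> the value would be the preimage
        of \<open>x\<close>, which differs from \<open>p x\<close>.\<close>
      then have "x \<in> \<Union>Y" using np(2)[OF x(2)] by (auto simp: sel_def split: if_splits)
      then obtain K' where K': "K' \<in> Y" "x \<in> K'" by blast
      then have "K' = K"
        using connected_component_eq(1)[of K x] connected_component_eq(1)[of K' x] K x XY by blast
      then show "K \<in> Y" using K' by simp
    qed
    fix X Y assume "X \<in> Pow ?K" "Y \<in> Pow ?K" "sel X = sel Y"
    then show "X = Y" using sub[of X Y] sub[of Y X] by auto
  qed
  moreover have "sel ` Pow ?K = ?L"
  proof
    show "sel ` Pow ?K \<subseteq> ?L" using sel_long by blast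
    show "?L \<subseteq> sel ` Pow ?K"
    proof
      fix q assume q: "q \<in> ?L"
      then have perm_q: "q permutes verts C" by (auto simp: long_permutations_def)
      \<comment> \<open>The agreement set with \<open>p\<close> is closed along edges, hence a union
        of components, and these components form the wanted \<open>X\<close>.\<close>
      define A where "A = {v \<in> verts C. q v = p v}"
      have closed: "w \<in> A" if "u \<in> A" "{u, w} \<in> edges C" for u w
        using that long_permutations_agreement_closed[OF q p, of u w]
          simple_graph_edgeD[OF simple that(2)] by (simp add: A_def)
      define X where "X = {K \<in> ?K. K \<subseteq> A}"
      have "\<Union>X = A"
      proof
        show "\<Union>X \<subseteq> A" by (auto simp: X_def)
        show "A \<subseteq> \<Union>X"
        proof
          fix v assume v: "v \<in> A"
          then obtain K where "K \<in> ?K" "v \<in> K"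
            using Union_connected_components by (auto simp: A_def)
          moreover then have "K \<subseteq> A" using connected_component_subset[OF _ _ v] closed by blast
          ultimately show "v \<in> \<Union>X" by (auto simp: X_def)
        qed
      qed
      have "sel X v = q v" for v
      proof (cases "v \<in> verts C")
        case True
        \<comment> \<open>Only two values are possible, so where \<open>q\<close> disagrees with
          \<open>p\<close> it must be the inverse of \<open>p\<close>.\<close>
        have "q v \<in> {p v, inv_into UNIV p v}"
          using np(1)[OF True] long_permutation_neighbors(1)[OF q True] by blast
        then show ?thesis using True unfolding sel_def \<open>\<Union>X = A\<close> by (auto simp: A_def)
      next
        case False
        then show ?thesis
          using permutes_not_in[OF perm] permutes_not_in[OF permutes_inv[OF perm]]
            permutes_not_in[OF perm_q] by (simp add: sel_def)
      qed
      then have "q = sel X" by auto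
      then show "q \<in> sel ` Pow ?K" by (auto simp: X_def)
    qed
  qed
  ultimately have "card ?L = card (Pow ?K)" by (metis card_image)
  then show ?thesis
    using finite_connected_components[OF finite_verts] by (simp add: card_Pow num_components_def)
qed

end

section \<open>Long permutations and matchings\<close>

text \<open>The invariant sets T are the unions of cycles of p, and the exponent counts the cycles
  chosen. Adding or removing the cycle through a fixed vertex x pairs the sets with opposite signs;
  a nonempty S is needed to have such an x.\<close>

lemma sum_invariant_num_components:
  assumes p: "p permutes S" and fin: "finite S" and "S \<noteq> {}"
  shows "(\<Sum>T | T \<subseteq> S \<and> p ` T = T. (- 1 :: 'b :: comm_ring_1) ^ num_components (permutation_graph T p)) = 0"
proof -
  obtain x where x: "x \<in> S" using \<open>S \<noteq> {}\<close> by blast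
  let ?O = "range (\<lambda>n. (p ^^ n) x)"
  let ?F = "\<lambda>T. (- 1 :: 'b) ^ num_components (permutation_graph T p)"
  have inj: "inj p" by (rule permutes_inj[OF p])
  have pow: "(p ^^ n) x \<in> T" if "p ` T = T" "x \<in> T" for n T
    using that by (induction n) auto
  \<comment> \<open>Injectivity pulls membership back along \<open>p\<close>, so an invariant set
    contains the whole orbit of \<open>x\<close> or none of it.\<close>
  have pow': "x \<in> T" if T: "p ` T = T" "(p ^^ n) x \<in> T" for n T
    using T(2)
  proof (induction n)
    case (Suc n)
    then have "p ((p ^^ n) x) \<in> p ` T" using T(1) by simp
    then show ?case using inj Suc.IH by (simp add: inj_image_mem_iff)
  qed simp
  have O_S: "?O \<subseteq> S" using pow[of S] permutes_image[OF p] x by auto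
  have x_O: "x \<in> ?O" by (rule range_eqI[of _ _ 0]) simp
  have "p ((p ^^ n) x) \<in> ?O" for n
    by (rule range_eqI[of _ _ "Suc n"]) simp
  then have O_sub: "p ` ?O \<subseteq> ?O" by auto
  have p_O: "p ` ?O = ?O"
    \<comment> \<open>Forward iterates are visibly mapped into themselves; on a finite set an
      injective self-map is onto, so the orbit is a full cycle.\<close>
    using O_sub finite_subset[OF O_S fin] permutes_inj_on[OF p] by (intro endo_inj_surj)
  have disj: "T \<inter> ?O = {}" if "p ` T = T" "x \<notin> T" for T
    using pow'[OF that(1)] that(2) by blast
  let ?A = "{T. T \<subseteq> S \<and> p ` T = T \<and> x \<notin> T}" and ?B = "{T. T \<subseteq> S \<and> p ` T = T \<and> x \<in> T}"
  have fins: "finite ?A" "finite ?B" using fin by auto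
  have "sum ?F ?B = (\<Sum>T\<in>?A. - ?F T)"
  proof (rule sum.reindex_bij_witness[where i = "\<lambda>T. T \<union> ?O" and j = "\<lambda>T. T - ?O"])
    fix T assume T: "T \<in> ?B"
    then have "?O \<subseteq> T" using pow[of T] by auto
    then show T_eq: "(T - ?O) \<union> ?O = T" by blast
    have "p ` (T - ?O) = T - ?O" using T p_O by (simp add: image_set_diff[OF inj])
    then show A: "T - ?O \<in> ?A" using T x_O by blast
    have fin_T: "finite T" using T fin finite_subset by blast
    have "num_components (permutation_graph T p)
        = num_components (permutation_graph (T - ?O) p) + num_components (permutation_graph ?O p)"
      using A O_sub T_eq fin_T
      by (intro num_components_disjoint_union) (auto simp flip: image_Un)
    also have "num_components (permutation_graph ?O p) = 1"
      by (rule num_components_transitive[OF x_O O_sub]) auto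
    finally show "- ?F (T - ?O) = ?F T" by simp
  next
    fix T assume T: "T \<in> ?A"
    then show "(T \<union> ?O) - ?O = T" using disj by blast
    show "T \<union> ?O \<in> ?B" using T O_S x_O p_O by (simp add: image_Un)
  qed
  moreover have "{T. T \<subseteq> S \<and> p ` T = T} = ?A \<union> ?B" by auto
  moreover have "sum ?F (?A \<union> ?B) = sum ?F ?A + sum ?F ?B"
    using fins by (intro sum.union_disjoint) auto
  ultimately show ?thesis by (simp add: sum_negf)
qed

text \<open>This is c(L) as it arises from the determinant: (-1)^|L| is the product of the
  off-diagonal entries -1 of x I - Q that a long permutation picks up.\<close>

definition signed_count :: "'a set set \<Rightarrow> 'a set \<Rightarrow> 'b :: comm_ring_1" where
  "signed_count E L = (\<Sum>r\<in>long_permutations E L. of_int (sign r) * (- 1) ^ card L)"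

lemma finite_long_permutations: "finite L \<Longrightarrow> finite (long_permutations E L)"
  by (rule finite_subset[OF _ finite_permutations]) (auto simp: long_permutations_def)

lemma signed_count_conv_num_components:
  assumes "finite L"
  shows "signed_count E L
    = (\<Sum>r\<in>long_permutations E L. (- 1 :: 'b :: comm_ring_1) ^ num_components (permutation_graph L r))"
  unfolding signed_count_def
proof (rule sum.cong)
  fix r assume "r \<in> long_permutations E L"
  then have "r permutes L" by (simp add: long_permutations_def)
  then have "of_int (sign r * (- 1) ^ card L)
      = (of_int ((- 1) ^ num_components (permutation_graph L r)) :: 'b)"
    using sign_conv_num_components assms by metis
  then show "of_int (sign r) * (- 1) ^ card L
      = (- 1 :: 'b) ^ num_components (permutation_graph L r)" by simp
qed simp

lemma long_permutations_comp_iff: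
  assumes "r permutes T" "q permutes U" "T \<inter> U = {}"
  shows "r \<circ> q \<in> long_permutations E (T \<union> U)
    \<longleftrightarrow> r \<in> long_permutations E T \<and> q \<in> long_permutations E U"
proof -
  have "r \<circ> q permutes T \<union> U"
    using permutes_subset[OF assms(1)] permutes_subset[OF assms(2)]
    by (intro permutes_compose) auto
  moreover have "(\<forall>v\<in>T. {v, (r \<circ> q) v} \<in> E \<and> (r \<circ> q) ((r \<circ> q) v) \<noteq> v)
      \<longleftrightarrow> (\<forall>v\<in>T. {v, r v} \<in> E \<and> r (r v) \<noteq> v)"
    by (intro ball_cong refl)
      (simp only: permutes_comp_disjoint(1)[OF assms] permutes_in_image[OF assms(1)])
  moreover have "(\<forall>v\<in>U. {v, (r \<circ> q) v} \<in> E \<and> (r \<circ> q) ((r \<circ> q) v) \<noteq> v)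
      \<longleftrightarrow> (\<forall>v\<in>U. {v, q v} \<in> E \<and> q (q v) \<noteq> v)"
    by (intro ball_cong refl)
      (simp only: permutes_comp_disjoint(2)[OF assms] permutes_in_image[OF assms(2)])
  ultimately show ?thesis
    using assms(1,2) unfolding long_permutations_def mem_Collect_eq ball_Un by blast
qed

text \<open>A long permutation of T and one of S - T combine to a long permutation p of S together
  with a p-invariant set T. Only the part on T carries signs, so after exchanging the sums the inner
  sum over T cancels for each p, except when S is empty.\<close>

lemma signed_count_convolution:
  assumes fin: "finite S"
  shows "(\<Sum>T\<in>Pow S. signed_count E T * of_nat (card (long_permutations E (S - T))))
    = (if S = {} then 1 else 0 :: 'b :: comm_ring_1)"
proof -
  let ?g = "\<lambda>T r. (- 1 :: 'b) ^ num_components (permutation_graph T r)"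
  have "(\<Sum>T\<in>Pow S. signed_count E T * of_nat (card (long_permutations E (S - T))))
      = (\<Sum>T\<in>Pow S. \<Sum>p | p \<in> long_permutations E S \<and> p ` T = T. ?g T p)"
  proof (rule sum.cong)
    fix T assume "T \<in> Pow S"
    then have T: "T \<subseteq> S" "finite T" using fin finite_subset by auto
    have split: "T \<inter> (S - T) = {}" "T \<union> (S - T) = S" using T by auto
    have "(\<Sum>p | p \<in> long_permutations E S \<and> p ` T = T. ?g T p)
        = (\<Sum>p | p permutes S \<and> p ` T = T. if p \<in> long_permutations E S then ?g T p else 0)"
      using finite_permutations[OF fin]
      by (intro sum.mono_neutral_cong_left) (auto simp: long_permutations_def)
    also have "\<dots> = (\<Sum>r | r permutes T. \<Sum>q | q permutes S - T.
        if r \<circ> q \<in> long_permutations E S then ?g T (r \<circ> q) else 0)"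
      by (rule sum_permutes_invariant[OF fin T(1)])
    also have "\<dots> = (\<Sum>r | r permutes T. \<Sum>q | q permutes S - T.
        (if r \<in> long_permutations E T then ?g T r else 0)
        * (if q \<in> long_permutations E (S - T) then 1 else 0))"
    proof (intro sum.cong refl)
      fix r q assume "r \<in> {r. r permutes T}" "q \<in> {q. q permutes S - T}"
      then have rq: "r permutes T" "q permutes S - T" by auto
      have "permutation_graph T (r \<circ> q) = permutation_graph T r"
        using permutes_comp_disjoint(1)[OF rq split(1)]
        by (auto simp: permutation_graph_def simp del: o_apply)
      then show "(if r \<circ> q \<in> long_permutations E S then ?g T (r \<circ> q) else 0)
          = (if r \<in> long_permutations E T then ?g T r else 0)
            * (if q \<in> long_permutations E (S - T) then 1 else 0)"
        using long_permutations_comp_iff[OF rq split(1), of E, unfolded split(2)] by simp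
    qed
    also have "\<dots> = (\<Sum>r | r permutes T. if r \<in> long_permutations E T then ?g T r else 0)
        * (\<Sum>q | q permutes S - T. if q \<in> long_permutations E (S - T) then 1 else 0)"
      by (simp only: sum_product)
    also have "(\<Sum>r | r permutes T. if r \<in> long_permutations E T then ?g T r else 0)
        = signed_count E T"
      unfolding signed_count_conv_num_components[OF T(2)]
      using finite_permutations[OF T(2)]
      by (intro sum.mono_neutral_cong_right) (auto simp: long_permutations_def)
    also have "(\<Sum>q | q permutes S - T. if q \<in> long_permutations E (S - T) then 1 else 0 :: 'b)
        = (\<Sum>q\<in>long_permutations E (S - T). 1)"
      using finite_permutations[of "S - T"] fin
      by (intro sum.mono_neutral_cong_right) (auto simp: long_permutations_def)
    finally show "signed_count E T * of_nat (card (long_permutations E (S - T)))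
        = (\<Sum>p | p \<in> long_permutations E S \<and> p ` T = T. ?g T p)" by simp
  qed simp
  also have "\<dots> = (\<Sum>p\<in>long_permutations E S. \<Sum>T | T \<in> Pow S \<and> p ` T = T. ?g T p)"
    using fin finite_long_permutations[OF fin] by (intro sum.swap_restrict) auto
  also have "\<dots> = (if S = {} then 1 else 0)"
  proof (cases "S = {}")
    case True
    then have "long_permutations E S = {id}" by (auto simp: long_permutations_def)
    then show ?thesis using True by (simp add: num_components_def)
  next
    case False
    then show ?thesis
      using sum_invariant_num_components[OF _ fin False]
      by (subst sum.neutral) (auto simp: long_permutations_def)
  qed
  finally show ?thesis .
qed

text \<open>Associativity of convolution: F = c * B and c * d = 1 give d * F = (d * c) * B = B. The
  value of F at every subset of W enters.\<close>

lemma set_convolution_inversion: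
  fixes F B c d :: "'a set \<Rightarrow> 'b :: comm_ring_1"
  assumes fin: "finite W"
    and F: "\<And>U. U \<subseteq> W \<Longrightarrow> F U = (\<Sum>T\<in>Pow U. c T * B (U - T))"
    and cd: "\<And>U. U \<subseteq> W \<Longrightarrow> (\<Sum>T\<in>Pow U. c T * d (U - T)) = (if U = {} then 1 else 0)"
  shows "B W = (\<Sum>S\<in>Pow W. d S * F (W - S))"
proof -
  have "(\<Sum>S\<in>Pow W. d S * F (W - S))
      = (\<Sum>S\<in>Pow W. \<Sum>T\<in>Pow (W - S). d S * c T * B (W - S - T))"
    by (intro sum.cong refl) (simp add: F sum_distrib_left mult.assoc)
  also have "\<dots> = (\<Sum>(S, T)\<in>(SIGMA S:Pow W. Pow (W - S)). d S * c T * B (W - S - T))"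
    using fin by (intro sum.Sigma) (auto intro: finite_subset)
  \<comment> \<open>Regrouping by U, the union of the disjoint sets S and T, brings c and d together
    and leaves B at the complement of U.\<close>
  also have "\<dots> = (\<Sum>(U, T)\<in>(SIGMA U:Pow W. Pow U). c T * d (U - T) * B (W - U))"
  proof (rule sum.reindex_bij_witness[where
        i = "\<lambda>(U, T). (U - T, T)" and j = "\<lambda>(S, T). (S \<union> T, T)"])
    fix x assume "x \<in> (SIGMA S:Pow W. Pow (W - S))"
    then obtain S T where x: "x = (S, T)" "S \<subseteq> W" "T \<subseteq> W - S" by auto
    then have "S \<union> T - T = S" "W - (S \<union> T) = W - S - T" by auto
    then show "(case case x of (S, T) \<Rightarrow> (S \<union> T, T) of (U, T) \<Rightarrow> (U - T, T)) = x"
      and "(case case x of (S, T) \<Rightarrow> (S \<union> T, T) of (U, T) \<Rightarrow> c T * d (U - T) * B (W - U))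
        = (case x of (S, T) \<Rightarrow> d S * c T * B (W - S - T))"
      using x(1) by (simp_all add: mult.commute)
    show "(case x of (S, T) \<Rightarrow> (S \<union> T, T)) \<in> (SIGMA U:Pow W. Pow U)"
      using x by auto
  qed auto
  also have "\<dots> = (\<Sum>U\<in>Pow W. (\<Sum>T\<in>Pow U. c T * d (U - T)) * B (W - U))"
    using fin by (subst sum.Sigma[symmetric]) (auto intro: finite_subset simp: sum_distrib_right)
  also have "\<dots> = (\<Sum>U\<in>Pow W. if U = {} then B W else 0)"
    by (intro sum.cong refl) (simp add: cd)
  also have "\<dots> = B W" using fin by (simp add: sum.delta)
  finally show ?thesis by simp
qed

section \<open>Matchings as involutions\<close>

definition matching_permutation :: "'a set set \<Rightarrow> 'a \<Rightarrow> 'a" where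
  "matching_permutation M v = (if v \<in> \<Union>M then THE w. {v, w} \<in> M else v)"

context
  fixes M :: "'a set set"
  assumes disj: "disjoint M" and card_2: "\<And>e. e \<in> M \<Longrightarrow> card e = 2"
begin

lemma matching_permutation_eq: "{v, w} \<in> M \<Longrightarrow> matching_permutation M v = w"
proof -
  assume vw: "{v, w} \<in> M"
  have "w' = w" if "{v, w'} \<in> M" for w'
  proof -
    \<comment> \<open>Two edges of the matching sharing \<open>v\<close> are equal, which makes the
      description by \<open>THE\<close> well defined.\<close>
    have "{v, w'} = {v, w}" using disjointD[OF disj that vw] by blast
    then show ?thesis by (metis doubleton_eq_iff)
  qed
  then have "(THE w. {v, w} \<in> M) = w" using vw by (intro the_equality)
  then show ?thesis using vw by (auto simp: matching_permutation_def)
qed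

lemma matching_partner:
  assumes "v \<in> \<Union>M" obtains w where "{v, w} \<in> M" "w \<noteq> v" "matching_permutation M v = w"
proof -
  obtain e where e: "e \<in> M" "v \<in> e" using assms by blast
  then obtain w where "e = {v, w}" "w \<noteq> v"
    using card_2[OF e(1)] by (auto simp: card_2_iff)
  then show ?thesis using that e matching_permutation_eq by blast
qed

lemma matching_permutation_involution: "matching_permutation M (matching_permutation M v) = v"
proof (cases "v \<in> \<Union>M")
  case True
  then obtain w where w: "{v, w} \<in> M" "matching_permutation M v = w" using matching_partner by blast
  then have "matching_permutation M w = v"
    by (intro matching_permutation_eq) (simp add: insert_commute)
  with w show ?thesis by simp
qed (simp add: matching_permutation_def)

lemma matching_permutation_permutes: "matching_permutation M permutes \<Union>M"
  unfolding permutes_def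
proof (intro conjI allI impI)
  show "matching_permutation M x = x" if "x \<notin> \<Union>M" for x
    using that by (simp add: matching_permutation_def)
  show "\<exists>!x. matching_permutation M x = y" for y
    using matching_permutation_involution by metis
qed

end

text \<open>Each new edge composes the involution with one transposition, disjoint from the earlier
  ones.\<close>

lemma sign_matching_permutation:
  assumes "finite M" "disjoint M" "\<And>e. e \<in> M \<Longrightarrow> card e = 2"
  shows "sign (matching_permutation M) = (- 1) ^ card M"
  using assms
proof (induction M rule: finite_induct)
  case empty
  have "matching_permutation {} = (id :: 'a \<Rightarrow> 'a)" by (auto simp: matching_permutation_def)
  then show ?case by simp
next
  case (insert e M)
  have M: "disjoint M" "\<And>e. e \<in> M \<Longrightarrow> card e = 2"
    using insert.prems by (auto simp: pairwise_insert)
  note M' = insert.prems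
  have "card e = 2" using insert.prems by simp
  then obtain a b where ab: "e = {a, b}" "a \<noteq> b" by (auto simp: card_2_iff)
  have e_M: "e \<inter> \<Union>M = {}"
    using insert.hyps(2) disjointD[OF insert.prems(1), of e] by auto
  have fin: "finite (\<Union>M)" using insert.hyps(1) M(2) by (metis card.infinite finite_Union zero_neq_numeral)
  have outside: "matching_permutation N v = v" if "v \<notin> \<Union>N" for N and v :: 'a
    using that by (simp add: matching_permutation_def)
  have "{a, b} \<in> insert e M" "{b, a} \<in> insert e M" using ab(1) by auto
  note in_M = this
  have swap: "matching_permutation (insert e M) a = b" "matching_permutation (insert e M) b = a"
    by (rule matching_permutation_eq[OF M'], assumption, rule in_M)+
  have ab_M: "a \<notin> \<Union>M" "b \<notin> \<Union>M" using e_M ab(1) by auto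
  have "matching_permutation (insert e M) v = (transpose a b \<circ> matching_permutation M) v" for v
  proof -
    consider "v \<in> \<Union>M" | "v = a" | "v = b" | "v \<notin> \<Union>(insert e M)" using ab by blast
    then show ?thesis
    proof cases
      case 1
      then obtain w where w: "{v, w} \<in> M" "matching_permutation M v = w"
        using matching_partner[OF M] by blast
      moreover have "matching_permutation (insert e M) v = w"
        using w(1) by (intro matching_permutation_eq[OF M']) simp_all
      moreover have "w \<noteq> a" "w \<noteq> b" using w(1) ab_M by auto
      ultimately show ?thesis by simp
    next
      case 2
      then show ?thesis using swap(1) outside[OF ab_M(1)] by simp
    next
      case 3
      then show ?thesis using swap(2) outside[OF ab_M(2)] by simp
    next
      case 4
      then have "v \<notin> \<Union>M" "v \<noteq> a" "v \<noteq> b" using ab(1) by auto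
      then show ?thesis using outside[OF 4] outside[of v M] by simp
    qed
  qed
  then have "matching_permutation (insert e M) = transpose a b \<circ> matching_permutation M" by blast
  moreover have "permutation (matching_permutation M)"
    unfolding permutation_permutes using matching_permutation_permutes[OF M] fin by blast
  ultimately have "sign (matching_permutation (insert e M)) = - sign (matching_permutation M)"
    using ab(2) by (simp only: sign_compose[OF permutation_swap_id] sign_swap_id) simp
  then show ?case using insert.IH[OF M] insert.hyps by simp
qed

lemma card_Union_matching:
  assumes "finite M" "disjoint M" "\<And>e. e \<in> M \<Longrightarrow> card e = 2"
  shows "card (\<Union>M) = 2 * card M"
proof -
  have "finite e" if "e \<in> M" for e
    using assms(3)[OF that] by (metis card.infinite zero_neq_numeral)
  then have "card (\<Union>M) = sum card M" using assms(2) by (intro card_Union_disjoint)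
  then show ?thesis using assms(3) by simp
qed

section \<open>Expansion of the determinant\<close>

text \<open>The entry of x I - Q(G), indexed by vertices instead of positions.\<close>

definition char_weight :: "'a graph \<Rightarrow> 'a \<Rightarrow> 'a \<Rightarrow> real poly" where
  "char_weight G u v =
    (if u = v then [:- real (vdegree G u), 1:] else if {u, v} \<in> edges G then - 1 else 0)"

definition perm_term :: "'a graph \<Rightarrow> 'a set \<Rightarrow> ('a \<Rightarrow> 'a) \<Rightarrow> real poly" where
  "perm_term G W p = of_int (sign p) * (\<Prod>v\<in>W. char_weight G v (p v))"

text \<open>Leibniz expansion of the principal minor of x I - Q(G) on W. Working on vertex sets lets
  W vary without choosing an enumeration of each subset.\<close>

definition perm_expansion :: "'a graph \<Rightarrow> 'a set \<Rightarrow> real poly" where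
  "perm_expansion G W = (\<Sum>p | p permutes W. perm_term G W p)"

lemma char_weight_edge:
  "simple_graph G \<Longrightarrow> {u, v} \<in> edges G \<Longrightarrow> char_weight G u v = - 1"
  using simple_graph_edgeD[of G u v] by (simp add: char_weight_def)

text \<open>The 2|M| matched vertices contribute entries -1 with product 1, so the sign (-1)^|M| of
  the matching polynomial is the sign of the permutation.\<close>

lemma perm_term_matching:
  assumes "simple_graph G" "finite U" "M \<subseteq> edges G" "\<Union>M \<subseteq> U" "disjoint M"
  shows "perm_term G U (matching_permutation M)
    = (- 1) ^ card M * (\<Prod>v\<in>U - \<Union>M. [:- real (vdegree G v), 1:])"
proof -
  have card_2: "card e = 2" if "e \<in> M" for e
    using assms(1,3) that by (auto simp: simple_graph_def)
  have "finite M" using assms(2,4) by (metis finite_UnionD finite_subset)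
  have "(\<Prod>v\<in>\<Union>M. char_weight G v (matching_permutation M v)) = (\<Prod>v\<in>\<Union>M. - 1)"
  proof (rule prod.cong)
    fix v assume "v \<in> \<Union>M"
    then obtain w where "{v, w} \<in> M" "matching_permutation M v = w"
      using matching_partner[OF assms(5) card_2] by blast
    then show "char_weight G v (matching_permutation M v) = - 1"
      using char_weight_edge[OF assms(1)] assms(3) by auto
  qed simp
  also have "\<dots> = 1"
    using card_Union_matching[OF \<open>finite M\<close> assms(5) card_2] by simp
  finally have "(\<Prod>v\<in>U. char_weight G v (matching_permutation M v))
      = (\<Prod>v\<in>U - \<Union>M. char_weight G v (matching_permutation M v))"
    using prod.subset_diff[OF assms(4,2), of "\<lambda>v. char_weight G v (matching_permutation M v)"]
    by simp
  also have "\<dots> = (\<Prod>v\<in>U - \<Union>M. [:- real (vdegree G v), 1:])"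
    by (intro prod.cong) (auto simp: matching_permutation_def char_weight_def)
  finally show ?thesis
    using sign_matching_permutation[OF \<open>finite M\<close> assms(5) card_2] by (simp add: perm_term_def)
qed

text \<open>An involution has a nonzero term only if it moves vertices along edges; its 2-cycles
  then form a matching, and its fixed points supply the factors x - d(v).\<close>

lemma laplacian_matching_poly_on_conv_involutions:
  assumes G: "simple_graph G" and U: "U \<subseteq> verts G"
  shows "laplacian_matching_poly_on G (induced_subgraph G U)
    = (\<Sum>q | q permutes U \<and> (\<forall>v\<in>U. q (q v) = v). perm_term G U q)"
proof -
  have fin: "finite U" using G U finite_subset by (auto simp: simple_graph_def)
  let ?I = "{q. q permutes U \<and> (\<forall>v\<in>U. q (q v) = v)}"
  let ?J = "{q \<in> ?I. \<forall>v\<in>U. q v \<noteq> v \<longrightarrow> {v, q v} \<in> edges G}"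
  let ?M = "{M. M \<subseteq> edges G \<and> \<Union>M \<subseteq> U \<and> disjoint M}"
  have "(\<Sum>q\<in>?I. perm_term G U q) = (\<Sum>q\<in>?J. perm_term G U q)"
  proof (rule sum.mono_neutral_right)
    show "finite ?I" using finite_permutations[OF fin] by (rule rev_finite_subset) auto
    show "\<forall>q\<in>?I - ?J. perm_term G U q = 0"
    proof
      fix q assume "q \<in> ?I - ?J"
      then obtain v where "v \<in> U" "q v \<noteq> v" "{v, q v} \<notin> edges G" by blast
      then have "char_weight G v (q v) = 0" "v \<in> U" by (auto simp: char_weight_def)
      then show "perm_term G U q = 0" using fin by (auto simp: perm_term_def prod_zero_iff)
    qed
  qed auto
  also have "\<dots> = (\<Sum>M\<in>?M. (- 1) ^ card M * (\<Prod>v\<in>U - \<Union>M. [:- real (vdegree G v), 1:]))"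
  proof (rule sum.reindex_bij_witness[where
        i = matching_permutation and j = "\<lambda>q. (\<lambda>v. {v, q v}) ` {v \<in> U. q v \<noteq> v}"])
    fix M assume M: "M \<in> ?M"
    then have disj: "disjoint M" and "M \<subseteq> edges G" and "\<Union>M \<subseteq> U" by auto
    have card_2: "card e = 2" if "e \<in> M" for e
      using G \<open>M \<subseteq> edges G\<close> that by (auto simp: simple_graph_def)
    note partner = matching_partner[OF disj card_2]
    show "(\<lambda>v. {v, matching_permutation M v}) ` {v \<in> U. matching_permutation M v \<noteq> v} = M"
    proof
      show "(\<lambda>v. {v, matching_permutation M v}) ` {v \<in> U. matching_permutation M v \<noteq> v} \<subseteq> M"
      proof clarify
        fix v assume "matching_permutation M v \<noteq> v"
        then have "v \<in> \<Union>M" by (metis matching_permutation_def)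
        then show "{v, matching_permutation M v} \<in> M" using partner by metis
      qed
      show "M \<subseteq> (\<lambda>v. {v, matching_permutation M v}) ` {v \<in> U. matching_permutation M v \<noteq> v}"
      proof
        fix e assume e: "e \<in> M"
        then obtain v w where vw: "e = {v, w}" "v \<noteq> w" using card_2[OF e] by (auto simp: card_2_iff)
        then have "matching_permutation M v = w"
          using matching_permutation_eq[OF disj card_2] e by blast
        moreover have "v \<in> U" using e vw \<open>\<Union>M \<subseteq> U\<close> by auto
        ultimately show "e \<in> (\<lambda>v. {v, matching_permutation M v}) ` {v \<in> U. matching_permutation M v \<noteq> v}"
          using vw by auto
      qed
    qed
    have "{v, matching_permutation M v} \<in> edges G" if "matching_permutation M v \<noteq> v" for v
    proof -
      have "v \<in> \<Union>M" using that by (metis matching_permutation_def)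
      then show ?thesis using partner \<open>M \<subseteq> edges G\<close> by (metis subsetD)
    qed
    then show "matching_permutation M \<in> ?J"
      using permutes_subset[OF matching_permutation_permutes[OF disj card_2] \<open>\<Union>M \<subseteq> U\<close>]
        matching_permutation_involution[OF disj card_2] by auto
  next
    fix q assume q: "q \<in> ?J"
    let ?M' = "(\<lambda>v. {v, q v}) ` {v \<in> U. q v \<noteq> v}"
    have perm: "q permutes U" and inv: "\<And>v. v \<in> U \<Longrightarrow> q (q v) = v"
      and edge: "\<And>v. v \<in> U \<Longrightarrow> q v \<noteq> v \<Longrightarrow> {v, q v} \<in> edges G" using q by auto
    have sub: "?M' \<subseteq> edges G" using edge by auto
    have Un: "\<Union>?M' = {v \<in> U. q v \<noteq> v}"
      using permutes_in_image[OF perm] inv by auto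
    have disj: "disjoint ?M'"
    proof (rule disjointI)
      fix a b assume "a \<in> ?M'" "b \<in> ?M'" "a \<noteq> b"
      then obtain u v where uv: "a = {u, q u}" "b = {v, q v}" "u \<in> U" "v \<in> U" by auto
      show "a \<inter> b = {}"
      proof (rule ccontr)
        assume "a \<inter> b \<noteq> {}"
        then consider "u = v" | "u = q v" | "q u = v" | "q u = q v" using uv by auto
        then have "a = b"
        proof cases
          case 1
          then show ?thesis using uv(1,2) by metis
        next
          case 2
          then show ?thesis using uv(1,2) inv[OF uv(4)] by (metis insert_commute)
        next
          case 3
          then show ?thesis using uv(1,2) inv[OF uv(3)] by (metis insert_commute)
        next
          case 4
          then have "u = v" using inv[OF uv(3)] inv[OF uv(4)] by metis
          then show ?thesis using uv(1,2) by metis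
        qed
        then show False using \<open>a \<noteq> b\<close> by simp
      qed
    qed
    show M': "?M' \<in> ?M" using sub Un disj by auto
    have card_2: "card e = 2" if "e \<in> ?M'" for e
      using G sub that by (auto simp: simple_graph_def)
    show q_eq: "matching_permutation ?M' = q"
    proof
      fix v
      show "matching_permutation ?M' v = q v"
      proof (cases "v \<in> \<Union>?M'")
        case True
        then have "{v, q v} \<in> ?M'" unfolding Un by blast
        then show ?thesis by (intro matching_permutation_eq[OF disj card_2])
      next
        case False
        then have "q v = v" unfolding Un using permutes_not_in[OF perm] by blast
        then show ?thesis unfolding matching_permutation_def using False by (simp only: if_False)
      qed
    qed
    have "\<Union>?M' \<subseteq> U" unfolding Un by (rule Collect_subset)
    from perm_term_matching[OF G fin sub this disj]
    show "(- 1) ^ card ?M' * (\<Prod>v\<in>U - \<Union>?M'. [:- real (vdegree G v), 1:]) = perm_term G U q"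
      unfolding q_eq by (rule sym)
  qed
  also have "?M = matchings (induced_subgraph G U)"
    by (auto simp: matchings_def induced_subgraph_def)
  finally have "(\<Sum>q\<in>?I. perm_term G U q) = (\<Sum>M\<in>matchings (induced_subgraph G U).
      (- 1) ^ card M * (\<Prod>v\<in>U - \<Union>M. [:- real (vdegree G v), 1:]))" .
  moreover have "verts (induced_subgraph G U) = U" using U by (auto simp: induced_subgraph_def)
  ultimately show ?thesis by (simp add: laplacian_matching_poly_on_def)
qed

text \<open>A permutation without fixed points or 2-cycles uses only off-diagonal entries: its term
  vanishes once it leaves the edges of G, and otherwise is free of x.\<close>

lemma sum_perm_term_long:
  assumes G: "simple_graph G" and fin: "finite T"
  shows "(\<Sum>r | r permutes T \<and> (\<forall>v\<in>T. r (r v) \<noteq> v). perm_term G T r)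
    = signed_count (edges G) T"
  unfolding signed_count_def
proof (rule sum.mono_neutral_cong_right)
  show "finite {r. r permutes T \<and> (\<forall>v\<in>T. r (r v) \<noteq> v)}"
    using finite_permutations[OF fin] by (rule rev_finite_subset) auto
  show "long_permutations (edges G) T \<subseteq> {r. r permutes T \<and> (\<forall>v\<in>T. r (r v) \<noteq> v)}"
    by (auto simp: long_permutations_def)
  show "\<forall>r\<in>{r. r permutes T \<and> (\<forall>v\<in>T. r (r v) \<noteq> v)} - long_permutations (edges G) T.
      perm_term G T r = 0"
  proof
    fix r assume r: "r \<in> {r. r permutes T \<and> (\<forall>v\<in>T. r (r v) \<noteq> v)} - long_permutations (edges G) T"
    then obtain v where v: "v \<in> T" "{v, r v} \<notin> edges G" "r (r v) \<noteq> v"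
      by (auto simp: long_permutations_def)
    then have "r v \<noteq> v" by auto
    with v have "char_weight G v (r v) = 0" by (auto simp: char_weight_def)
    then show "perm_term G T r = 0" using v fin by (auto simp: perm_term_def prod_zero_iff)
  qed
  show "perm_term G T r = of_int (sign r) * (- 1) ^ card T"
    if "r \<in> long_permutations (edges G) T" for r
  proof -
    have "(\<Prod>v\<in>T. char_weight G v (r v)) = (\<Prod>v\<in>T. - 1)"
      using that char_weight_edge[OF G] by (intro prod.cong) (auto simp: long_permutations_def)
    then show ?thesis by (simp add: perm_term_def)
  qed
qed

lemma perm_term_comp:
  assumes "r permutes T" "q permutes U" "T \<inter> U = {}" "finite T" "finite U"
  shows "perm_term G (T \<union> U) (r \<circ> q) = perm_term G T r * perm_term G U q"
proof -
  have "sign (r \<circ> q) = sign r * sign q"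
    using assms by (intro sign_compose) (auto simp: permutation_permutes)
  moreover have "(\<Prod>v\<in>T. char_weight G v ((r \<circ> q) v)) = (\<Prod>v\<in>T. char_weight G v (r v))"
    by (intro prod.cong refl) (simp only: permutes_comp_disjoint(1)[OF assms(1-3)])
  moreover have "(\<Prod>v\<in>U. char_weight G v ((r \<circ> q) v)) = (\<Prod>v\<in>U. char_weight G v (q v))"
    by (intro prod.cong refl) (simp only: permutes_comp_disjoint(2)[OF assms(1-3)])
  ultimately show ?thesis
    using prod.union_disjoint[OF assms(4,5,3), of "\<lambda>v. char_weight G v ((r \<circ> q) v)"]
    unfolding perm_term_def by (simp only: of_int_mult mult_ac)
qed

text \<open>A permutation splits into its cycles of length at least three and an involution on the
  remaining vertices.\<close>

lemma perm_expansion_conv_matching_poly: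
  assumes G: "simple_graph G" and W: "W \<subseteq> verts G"
  shows "perm_expansion G W = (\<Sum>T\<in>Pow W. signed_count (edges G) T
    * laplacian_matching_poly_on G (induced_subgraph G (W - T)))"
proof -
  have fin: "finite W" using G W finite_subset by (auto simp: simple_graph_def)
  \<comment> \<open>The vertices lying on cycles of length at least three.\<close>
  let ?long = "\<lambda>p. {v \<in> W. p (p v) \<noteq> v}"
  have "perm_expansion G W
      = (\<Sum>T\<in>Pow W. \<Sum>p | p \<in> {p. p permutes W} \<and> ?long p = T. perm_term G W p)"
    unfolding perm_expansion_def
    by (rule sum.group[symmetric]) (use fin finite_permutations in auto)
  also have "\<dots> = (\<Sum>T\<in>Pow W. signed_count (edges G) T
    * laplacian_matching_poly_on G (induced_subgraph G (W - T)))"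
  proof (rule sum.cong)
    fix T assume "T \<in> Pow W"
    then have T: "T \<subseteq> W" "finite T" and fin': "finite (W - T)" using fin finite_subset by auto
    have split: "T \<inter> (W - T) = {}" "T \<union> (W - T) = W" using T by auto
    \<comment> \<open>By injectivity of \<open>p\<close>, if two steps do not return to v, they do
      not return to \<open>p v\<close> either.\<close>
    have inv: "p ` T = T" if "p permutes W" "?long p = T" for p
    proof (rule endo_inj_surj[OF T(2)])
      show "p ` T \<subseteq> T"
        using that permutes_in_image[OF that(1)] permutes_inj[OF that(1)] by (auto simp: inj_eq)
      show "inj_on p T" by (rule permutes_inj_on[OF that(1)])
    qed
    have "(\<Sum>p | p \<in> {p. p permutes W} \<and> ?long p = T. perm_term G W p)
        = (\<Sum>p | p permutes W \<and> p ` T = T. if ?long p = T then perm_term G W p else 0)"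
      using finite_permutations[OF fin] inv by (intro sum.mono_neutral_cong_left) auto
    also have "\<dots> = (\<Sum>r | r permutes T. \<Sum>q | q permutes W - T.
        if ?long (r \<circ> q) = T then perm_term G W (r \<circ> q) else 0)"
      by (rule sum_permutes_invariant[OF fin T(1)])
    also have "\<dots> = (\<Sum>r | r permutes T. \<Sum>q | q permutes W - T.
        (if \<forall>v\<in>T. r (r v) \<noteq> v then perm_term G T r else 0)
        * (if \<forall>v\<in>W - T. q (q v) = v then perm_term G (W - T) q else 0))"
    proof (intro sum.cong refl)
      fix r q assume "r \<in> {r. r permutes T}" "q \<in> {q. q permutes W - T}"
      then have rq: "r permutes T" "q permutes W - T" by auto
      \<comment> \<open>Prescribing the long part to be exactly \<open>T\<close> separates into a
        condition on \<open>r\<close> and one on \<open>q\<close>, so the double sum becomes a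
        product.\<close>
      have "?long (r \<circ> q) = T \<longleftrightarrow> (\<forall>v\<in>T. (r \<circ> q) ((r \<circ> q) v) \<noteq> v)
          \<and> (\<forall>v\<in>W - T. (r \<circ> q) ((r \<circ> q) v) = v)"
        using T(1) by blast
      moreover have "(\<forall>v\<in>T. (r \<circ> q) ((r \<circ> q) v) \<noteq> v) \<longleftrightarrow> (\<forall>v\<in>T. r (r v) \<noteq> v)"
        by (intro ball_cong refl)
          (simp only: permutes_comp_disjoint(1)[OF rq split(1)] permutes_in_image[OF rq(1)])
      moreover have "(\<forall>v\<in>W - T. (r \<circ> q) ((r \<circ> q) v) = v) \<longleftrightarrow> (\<forall>v\<in>W - T. q (q v) = v)"
        by (intro ball_cong refl)
          (simp only: permutes_comp_disjoint(2)[OF rq split(1)] permutes_in_image[OF rq(2)])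
      moreover have "perm_term G W (r \<circ> q) = perm_term G T r * perm_term G (W - T) q"
        using perm_term_comp[OF rq split(1) T(2) fin'] split(2) by simp
      ultimately show "(if ?long (r \<circ> q) = T then perm_term G W (r \<circ> q) else 0)
          = (if \<forall>v\<in>T. r (r v) \<noteq> v then perm_term G T r else 0)
            * (if \<forall>v\<in>W - T. q (q v) = v then perm_term G (W - T) q else 0)"
        by (simp only: if_distrib[of "\<lambda>x. x * _"] if_distrib[of "\<lambda>x. _ * x"] mult_zero_left
            mult_zero_right split: if_split) blast
    qed
    also have "\<dots> = (\<Sum>r | r permutes T. if \<forall>v\<in>T. r (r v) \<noteq> v then perm_term G T r else 0)
        * (\<Sum>q | q permutes W - T. if \<forall>v\<in>W - T. q (q v) = v then perm_term G (W - T) q else 0)"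
      by (simp only: sum_product)
    also have "(\<Sum>r | r permutes T. if \<forall>v\<in>T. r (r v) \<noteq> v then perm_term G T r else 0)
        = signed_count (edges G) T"
      unfolding sum_perm_term_long[OF G T(2), symmetric]
      using finite_permutations[OF T(2)] by (intro sum.mono_neutral_cong_right) auto
    also have "(\<Sum>q | q permutes W - T. if \<forall>v\<in>W - T. q (q v) = v then perm_term G (W - T) q else 0)
        = laplacian_matching_poly_on G (induced_subgraph G (W - T))"
      unfolding laplacian_matching_poly_on_conv_involutions[OF G subset_trans[OF Diff_subset W]]
      using finite_permutations[OF fin'] by (intro sum.mono_neutral_cong_right) auto
    finally show "(\<Sum>p | p \<in> {p. p permutes W} \<and> ?long p = T. perm_term G W p)
      = signed_count (edges G) T * laplacian_matching_poly_on G (induced_subgraph G (W - T))" .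
  qed simp
  finally show ?thesis .
qed

section \<open>Sums over 2-regular subgraphs\<close>

text \<open>The neighbours of v are its image and its preimage, distinct because v lies on no
  2-cycle and is not fixed.\<close>

lemma permutation_graph_two_regular:
  assumes G: "simple_graph G" and L: "L \<subseteq> verts G" and r: "r \<in> long_permutations (edges G) L"
  shows "subgraph (permutation_graph L r) G" "regular_graph 2 (permutation_graph L r)"
proof -
  have perm: "r permutes L" and edge: "\<And>v. v \<in> L \<Longrightarrow> {v, r v} \<in> edges G"
    and long: "\<And>v. v \<in> L \<Longrightarrow> r (r v) \<noteq> v"
    using r by (auto simp: long_permutations_def)
  have fin: "finite L" using G L finite_subset by (auto simp: simple_graph_def)
  have "card {v, r v} = 2" "{v, r v} \<subseteq> L" if "v \<in> L" for v
    using G edge[OF that] permutes_in_image[OF perm] that by (auto simp: simple_graph_def)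
  then have simple: "simple_graph (permutation_graph L r)"
    using fin by (auto simp: simple_graph_def)
  then show "subgraph (permutation_graph L r) G"
    using L edge by (auto simp: subgraph_def)
  have "vdegree (permutation_graph L r) v = 2" if v: "v \<in> L" for v
  proof -
    have inv_L: "inv_into UNIV r v \<in> L"
      using v permutes_in_image[OF permutes_inv[OF perm]] by simp
    have r_inv: "r (inv_into UNIV r v) = v" by (rule permutes_inverses(1)[OF perm])
    have "{w. {v, w} \<in> edges (permutation_graph L r)} = {r v, inv_into UNIV r v}"
    proof
      show "{w. {v, w} \<in> edges (permutation_graph L r)} \<subseteq> {r v, inv_into UNIV r v}"
      proof
        fix w assume "w \<in> {w. {v, w} \<in> edges (permutation_graph L r)}"
        then obtain u where "{v, w} = {u, r u}" by auto
        then show "w \<in> {r v, inv_into UNIV r v}"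
          using permutes_inverses(2)[OF perm, of u] by (auto simp: doubleton_eq_iff)
      qed
      have "{v, inv_into UNIV r v} = {inv_into UNIV r v, r (inv_into UNIV r v)}"
        using r_inv by auto
      then show "{r v, inv_into UNIV r v} \<subseteq> {w. {v, w} \<in> edges (permutation_graph L r)}"
        using v inv_L by auto
    qed
    moreover have "r v \<noteq> inv_into UNIV r v" using long[OF v] r_inv by metis
    ultimately show ?thesis unfolding vdegree_conv_neighbors[OF simple] by simp
  qed
  then show "regular_graph 2 (permutation_graph L r)" by (simp add: regular_graph_def)
qed

text \<open>For L = {} this still contains the graph without vertices, so that the convolutions
  include their term at the empty set.\<close>

definition two_regular_on :: "'a graph \<Rightarrow> 'a set \<Rightarrow> 'a graph set" where
  "two_regular_on G L = {C. subgraph C G \<and> regular_graph 2 C \<and> verts C = L}"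

lemma finite_subgraphs:
  assumes "simple_graph G"
  shows "finite {C. subgraph C G}"
proof -
  have "finite (verts G)" "edges G \<subseteq> Pow (verts G)"
    using assms by (auto simp: simple_graph_def)
  then have fin: "finite (Pow (verts G) \<times> Pow (edges G))"
    using finite_subset[of "edges G" "Pow (verts G)"] by simp
  have "C \<in> (\<lambda>(V, E). Graph V E) ` (Pow (verts G) \<times> Pow (edges G))" if C: "subgraph C G" for C
  proof (rule image_eqI)
    show "C = (case (verts C, edges C) of (V, E) \<Rightarrow> Graph V E)" by simp
    show "(verts C, edges C) \<in> Pow (verts G) \<times> Pow (edges G)"
      using C by (simp add: subgraph_def)
  qed
  then have "{C. subgraph C G} \<subseteq> (\<lambda>(V, E). Graph V E) ` (Pow (verts G) \<times> Pow (edges G))"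
    by (intro subsetI) (simp only: mem_Collect_eq)
  then show ?thesis by (rule finite_subset) (rule finite_imageI[OF fin])
qed

text \<open>Permutations with the same underlying graph C are its orientations, 2^omega(C) in
  number. Taking h as (-1)^omega turns c into a sum over subgraphs, and h = 1 does so for d.\<close>

lemma sum_long_permutations:
  fixes h :: "'a graph \<Rightarrow> 'b :: comm_ring_1"
  assumes G: "simple_graph G" and L: "L \<subseteq> verts G"
  shows "(\<Sum>r\<in>long_permutations (edges G) L. h (permutation_graph L r))
    = (\<Sum>C\<in>two_regular_on G L. 2 ^ num_components C * h C)"
proof -
  have fin: "finite L" using G L finite_subset by (auto simp: simple_graph_def)
  have "(\<Sum>r\<in>long_permutations (edges G) L. h (permutation_graph L r))
      = (\<Sum>C\<in>two_regular_on G L.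
          \<Sum>r | r \<in> long_permutations (edges G) L \<and> permutation_graph L r = C.
            h (permutation_graph L r))"
  proof (rule sum.group[symmetric])
    show "finite (two_regular_on G L)"
      by (rule finite_subset[OF _ finite_subgraphs[OF G]]) (auto simp: two_regular_on_def)
    show "permutation_graph L ` long_permutations (edges G) L \<subseteq> two_regular_on G L"
      using permutation_graph_two_regular[OF G L] by (auto simp: two_regular_on_def)
  qed (rule finite_long_permutations[OF fin])
  also have "\<dots> = (\<Sum>C\<in>two_regular_on G L. 2 ^ num_components C * h C)"
  proof (rule sum.cong)
    fix C assume "C \<in> two_regular_on G L"
    then have C: "subgraph C G" "regular_graph 2 C" "verts C = L"
      by (auto simp: two_regular_on_def)
    interpret two_regular C using C by unfold_locales (auto simp: subgraph_def)
    \<comment> \<open>The fibre over \<open>C\<close>: long permutations along edges of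
      \<open>C\<close> automatically use every edge of \<open>C\<close>.\<close>
    have "{r. r \<in> long_permutations (edges G) L \<and> permutation_graph L r = C}
        = long_permutations (edges C) (verts C)"
    proof (intro subset_antisym subsetI)
      fix r assume "r \<in> {r. r \<in> long_permutations (edges G) L \<and> permutation_graph L r = C}"
      then have r: "r \<in> long_permutations (edges G) L" "permutation_graph L r = C" by auto
      have "edges C = (\<lambda>v. {v, r v}) ` L" unfolding r(2)[symmetric] by simp
      then show "r \<in> long_permutations (edges C) (verts C)"
        using r(1) C(3) by (auto simp: long_permutations_def)
    next
      fix r assume r: "r \<in> long_permutations (edges C) (verts C)"
      then have "r \<in> long_permutations (edges G) L"
        using C by (auto simp: long_permutations_def subgraph_def)
      then show "r \<in> {r. r \<in> long_permutations (edges G) L \<and> permutation_graph L r = C}"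
        using permutation_graph_long_permutation[OF r] C(3) by simp
    qed
    moreover have "(\<Sum>r | r \<in> long_permutations (edges G) L \<and> permutation_graph L r = C.
        h (permutation_graph L r))
        = (\<Sum>r | r \<in> long_permutations (edges G) L \<and> permutation_graph L r = C. h C)"
      by (intro sum.cong refl) auto
    ultimately show "(\<Sum>r | r \<in> long_permutations (edges G) L \<and> permutation_graph L r = C.
        h (permutation_graph L r)) = 2 ^ num_components C * h C"
      using card_long_permutations by simp
  qed simp
  finally show ?thesis .
qed

lemma signed_count_conv_two_regular:
  assumes G: "simple_graph G" and L: "L \<subseteq> verts G"
  shows "signed_count (edges G) L
    = (\<Sum>C\<in>two_regular_on G L. (- 2 :: 'b :: comm_ring_1) ^ num_components C)"
proof -
  have "finite L" using G L finite_subset by (auto simp: simple_graph_def)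
  then show ?thesis
    using sum_long_permutations[OF G L, of "\<lambda>C. (- 1 :: 'b) ^ num_components C"]
    by (simp add: signed_count_conv_num_components flip: power_mult_distrib)
qed

lemma card_long_permutations_conv_two_regular:
  assumes "simple_graph G" "L \<subseteq> verts G"
  shows "of_nat (card (long_permutations (edges G) L))
    = (\<Sum>C\<in>two_regular_on G L. (2 :: 'b :: comm_ring_1) ^ num_components C)"
  using sum_long_permutations[OF assms, of "\<lambda>_. 1 :: 'b"] by simp

text \<open>The graph without vertices is the only contribution at L = {}; it has weight 1 and
  produces the term that both identities list separately.\<close>

lemma sum_two_regular_on:
  fixes a :: "'a graph \<Rightarrow> 'b :: comm_ring_1"
  assumes G: "simple_graph G" and empty: "\<And>C. verts C = {} \<Longrightarrow> a C = 1"
  shows "(\<Sum>L\<in>Pow (verts G). (\<Sum>C\<in>two_regular_on G L. a C) * F L)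
    = F {} + (\<Sum>C\<in>two_regular_subgraphs G. a C * F (verts C))"
proof -
  let ?R = "{C. subgraph C G \<and> regular_graph 2 C}"
  have fin: "finite ?R" by (rule finite_subset[OF _ finite_subgraphs[OF G]]) auto
  have "(\<Sum>L\<in>Pow (verts G). (\<Sum>C\<in>two_regular_on G L. a C) * F L)
      = (\<Sum>L\<in>Pow (verts G). \<Sum>C | C \<in> ?R \<and> verts C = L. a C * F (verts C))"
  proof (rule sum.cong)
    fix L
    have "(\<Sum>C | C \<in> ?R \<and> verts C = L. a C * F (verts C)) = (\<Sum>C\<in>two_regular_on G L. a C * F L)"
      by (rule sum.cong) (auto simp: two_regular_on_def)
    then show "(\<Sum>C\<in>two_regular_on G L. a C) * F L
        = (\<Sum>C | C \<in> ?R \<and> verts C = L. a C * F (verts C))"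
      by (simp add: sum_distrib_right)
  qed simp
  also have "\<dots> = (\<Sum>C\<in>?R. a C * F (verts C))"
    by (rule sum.group[OF fin]) (use G in \<open>auto simp: simple_graph_def subgraph_def\<close>)
  also have "?R = insert (Graph {} {}) (two_regular_subgraphs G)"
  proof (intro subset_antisym subsetI)
    fix C assume C: "C \<in> ?R"
    \<comment> \<open>Without vertices an edge would be an empty set of cardinality 2.\<close>
    have "C = Graph {} {}" if "verts C = {}"
    proof -
      have "e = {} \<and> card e = 2" if "e \<in> edges C" for e
        using C \<open>verts C = {}\<close> that by (auto simp: subgraph_def simple_graph_def)
      then have "edges C = {}" by fastforce
      with that show ?thesis by (cases C) simp
    qed
    then show "C \<in> insert (Graph {} {}) (two_regular_subgraphs G)"
      using C by (auto simp: two_regular_subgraphs_def)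
  qed (auto simp: two_regular_subgraphs_def subgraph_def simple_graph_def regular_graph_def)
  also have "(\<Sum>C\<in>insert (Graph {} {}) (two_regular_subgraphs G). a C * F (verts C))
      = F {} + (\<Sum>C\<in>two_regular_subgraphs G. a C * F (verts C))"
  proof (subst sum.insert)
    show "finite (two_regular_subgraphs G)"
      by (rule finite_subset[OF _ fin]) (auto simp: two_regular_subgraphs_def)
  qed (simp_all add: two_regular_subgraphs_def empty)
  finally show ?thesis .
qed

section \<open>Characteristic polynomials\<close>

text \<open>Transporting permutations of positions along the enumeration f preserves signs and
  matches the Leibniz terms. With f arbitrary, the full matrix and its principal submatrices are
  treated alike.\<close>

lemma char_poly_conv_perm_expansion:
  fixes A :: "real mat"
  assumes A: "A \<in> carrier_mat n n" and f: "bij_betw f {0..<n} W"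
    and entry: "\<And>i j. i < n \<Longrightarrow> j < n \<Longrightarrow> A $$ (i, j)
      = (if i = j then real (vdegree G (f i)) else if {f i, f j} \<in> edges G then 1 else 0)"
  shows "char_poly A = perm_expansion G W"
proof -
  let ?N = "{0..<n}" and ?g = "inv_into {0..<n} f"
  have inj: "inj_on f ?N" and img: "f ` ?N = W" using f by (auto simp: bij_betw_def)
  have g: "bij_betw ?g W ?N" by (rule bij_betw_inv_into[OF f])
  have weight: "char_poly_matrix A $$ (i, j) = char_weight G (f i) (f j)" if "i < n" "j < n" for i j
    using A that entry[OF that] inj
    by (auto simp: char_poly_matrix_def char_weight_def inj_on_eq_iff)
  have "char_poly A = (\<Sum>p | p permutes ?N.
      of_int (sign p) * (\<Prod>i = 0..<n. char_poly_matrix A $$ (i, p i)))"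
    unfolding char_poly_def using A by (intro det_def') simp
  also have "\<dots> = (\<Sum>q | q permutes W. perm_term G W q)"
  proof (rule sum.reindex_bij_witness[where
        i = "map_permutation W ?g" and j = "map_permutation ?N f"])
    fix p assume "p \<in> {p. p permutes ?N}"
    then have p: "p permutes ?N" by simp
    show "map_permutation ?N f p \<in> {q. q permutes W}"
      using map_permutation_permutes[OF f p] by simp
    show "map_permutation W ?g (map_permutation ?N f p) = p"
      by (rule map_permutation_compose_inv[OF f p]) (simp add: inj)
    have "(\<Prod>v\<in>W. char_weight G v (map_permutation ?N f p v))
        = (\<Prod>i\<in>?N. char_weight G (f i) (map_permutation ?N f p (f i)))"
      by (rule prod.reindex_bij_betw[OF f, symmetric])
    also have "\<dots> = (\<Prod>i\<in>?N. char_poly_matrix A $$ (i, p i))"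
      using permutes_in_image[OF p] by (intro prod.cong) (auto simp: map_permutation_apply[OF inj] weight)
    finally show "perm_term G W (map_permutation ?N f p)
        = of_int (sign p) * (\<Prod>i = 0..<n. char_poly_matrix A $$ (i, p i))"
      using sign_map_permutation[OF inj p] by (simp add: perm_term_def)
  next
    fix q assume "q \<in> {q. q permutes W}"
    then have q: "q permutes W" by simp
    show "map_permutation W ?g q \<in> {p. p permutes ?N}"
      using map_permutation_permutes[OF g q] by simp
    show "map_permutation ?N f (map_permutation W ?g q) = q"
      by (rule map_permutation_compose_inv[OF g q]) (use img in \<open>auto intro: f_inv_into_f\<close>)
  qed
  finally show ?thesis by (simp add: perm_expansion_def)
qed

text \<open>The index is recovered from the picked element as the number of smaller elements of I,
  which gives injectivity; the cardinalities do the rest.\<close>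

lemma bij_betw_pick:
  assumes "finite I"
  shows "bij_betw (pick I) {0..<card I} I"
proof -
  have "inj_on (pick I) {0..<card I}"
  proof (rule inj_onI)
    fix x y assume xy: "x \<in> {0..<card I}" "y \<in> {0..<card I}" "pick I x = pick I y"
    have "x < card I" "y < card I" using xy by simp_all
    then have "x = card {a \<in> I. a < pick I x}" "y = card {a \<in> I. a < pick I y}"
      by (simp_all only: card_pick_le)
    then show "x = y" using xy(3) by metis
  qed
  moreover have "pick I ` {0..<card I} \<subseteq> I" using pick_in_set_le[of _ I] by auto
  ultimately show ?thesis
    using assms by (intro bij_betw_imageI card_subset_eq) (auto simp: card_image)
qed

lemma signless_laplacian_carrier [simp]:
  "signless_laplacian vs G \<in> carrier_mat (length vs) (length vs)"
  by (simp add: signless_laplacian_def degree_matrix_def adjacency_matrix_def)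

lemma signless_laplacian_entry:
  assumes "simple_graph G" "i < length vs" "j < length vs"
  shows "signless_laplacian vs G $$ (i, j) = (if i = j then real (vdegree G (vs ! i))
    else if {vs ! i, vs ! j} \<in> edges G then 1 else 0)"
proof -
  \<comment> \<open>Without loops the adjacency matrix adds nothing to the diagonal.\<close>
  have "{v, v} \<notin> edges G" for v using simple_graph_edgeD(1)[OF assms(1)] by blast
  then show ?thesis
    using assms by (simp add: signless_laplacian_def degree_matrix_def adjacency_matrix_def)
qed

text \<open>The submatrix is cut out of Q(G), so its diagonal keeps the degrees of G, as
  \<open>perm_expansion\<close> demands. Its rows follow the enumeration \<open>vs\<close>
  restricted to the picked positions.\<close>

lemma char_poly_principal_submatrix:
  assumes G: "simple_graph G" and vs: "distinct vs" "set vs = verts G" and W: "W \<subseteq> verts G"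
  shows "char_poly (principal_submatrix vs (signless_laplacian vs G) W) = perm_expansion G W"
proof -
  let ?Q = "signless_laplacian vs G" and ?I = "{i. i < length vs \<and> vs ! i \<in> W}"
  have fin: "finite ?I" by simp
  have dim: "dim_row ?Q = length vs" "dim_col ?Q = length vs"
    using carrier_matD[OF signless_laplacian_carrier] by auto
  have I_eq: "{i. i < length vs \<and> i \<in> ?I} = ?I" by auto
  have pick: "bij_betw (pick ?I) {0..<card ?I} ?I" by (rule bij_betw_pick[OF fin])
  have pick_less: "pick ?I i < length vs" if "i < card ?I" for i
    using pick that by (auto simp: bij_betw_def)
  have nth: "bij_betw ((!) vs) ?I W"
  proof (rule bij_betw_imageI)
    show "inj_on ((!) vs) ?I" using vs(1) by (auto simp: inj_on_def nth_eq_iff_index_eq)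
    show "(!) vs ` ?I = W" using W vs(2) by (auto simp: image_iff in_set_conv_nth) (metis in_mono in_set_conv_nth)
  qed
  show ?thesis
  proof (rule char_poly_conv_perm_expansion)
    show "principal_submatrix vs ?Q W \<in> carrier_mat (card ?I) (card ?I)"
      unfolding principal_submatrix_def by (rule carrier_matI) (simp_all add: dim_submatrix dim I_eq)
    show "bij_betw ((!) vs \<circ> pick ?I) {0..<card ?I} W" by (rule bij_betw_trans[OF pick nth])
    fix i j assume ij: "i < card ?I" "j < card ?I"
    have "principal_submatrix vs ?Q W $$ (i, j) = ?Q $$ (pick ?I i, pick ?I j)"
      unfolding principal_submatrix_def using ij by (intro submatrix_index) (simp_all add: dim I_eq)
    moreover have "pick ?I i = pick ?I j \<longleftrightarrow> i = j"
      using ij inj_on_eq_iff[OF bij_betw_imp_inj_on[OF pick]] by simp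
    ultimately show "principal_submatrix vs ?Q W $$ (i, j)
        = (if i = j then real (vdegree G (((!) vs \<circ> pick ?I) i))
          else if {((!) vs \<circ> pick ?I) i, ((!) vs \<circ> pick ?I) j} \<in> edges G then 1 else 0)"
      using signless_laplacian_entry[OF G pick_less pick_less, OF ij] by simp
  qed
qed

lemma char_poly_signless_laplacian:
  assumes "simple_graph G" "distinct vs" "set vs = verts G"
  shows "char_poly (signless_laplacian vs G) = perm_expansion G (verts G)"
proof (rule char_poly_conv_perm_expansion)
  show "bij_betw ((!) vs) {0..<length vs} (verts G)"
    using bij_betw_nth[OF assms(2), of "{0..<length vs}" "verts G"] assms(3)
    by (simp add: atLeast0LessThan)
qed (use signless_laplacian_entry[OF assms(1)] in auto)

theorem theorem4p2:
  fixes G :: "'a graph" and vs :: "'a list"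
  assumes "simple_graph G"
    and "distinct vs" and "set vs = verts G"
  shows "char_poly (signless_laplacian vs G) =
      laplacian_matching_poly G
      + (\<Sum>C\<in>two_regular_subgraphs G.
           (- 2) ^ num_components C * laplacian_matching_poly_on G (graph_diff G C))
    \<and> laplacian_matching_poly G =
      char_poly (signless_laplacian vs G)
      + (\<Sum>C\<in>two_regular_subgraphs G.
           2 ^ num_components C
             * char_poly (principal_submatrix vs (signless_laplacian vs G) (verts G - verts C)))"
proof
  note G = assms(1)
  let ?V = "verts G" and ?B = "\<lambda>U. laplacian_matching_poly_on G (induced_subgraph G U)"
  have fin: "finite ?V" using G by (simp add: simple_graph_def)
  have "edges G \<subseteq> Pow ?V" using G by (auto simp: simple_graph_def)
  then have "induced_subgraph G ?V = G" by (cases G) (auto simp: induced_subgraph_def)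
  then have B_V: "?B ?V = laplacian_matching_poly G" by (simp add: laplacian_matching_poly_def)
  have empty: "x ^ num_components C = 1" if "verts C = {}" for C :: "'a graph" and x :: "real poly"
    using that by (simp add: num_components_def)
  have "perm_expansion G ?V
      = (\<Sum>L\<in>Pow ?V. (\<Sum>C\<in>two_regular_on G L. (- 2) ^ num_components C) * ?B (?V - L))"
    unfolding perm_expansion_conv_matching_poly[OF G subset_refl]
    by (intro sum.cong refl) (simp add: signed_count_conv_two_regular[OF G])
  also have "\<dots> = ?B (?V - {})
      + (\<Sum>C\<in>two_regular_subgraphs G. (- 2) ^ num_components C * ?B (?V - verts C))"
    by (rule sum_two_regular_on[OF G]) (rule empty)
  finally show "char_poly (signless_laplacian vs G) = laplacian_matching_poly G
      + (\<Sum>C\<in>two_regular_subgraphs G.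
           (- 2) ^ num_components C * laplacian_matching_poly_on G (graph_diff G C))"
    by (simp add: char_poly_signless_laplacian[OF assms] B_V graph_diff_def)
  have "?B ?V = (\<Sum>L\<in>Pow ?V. of_nat (card (long_permutations (edges G) L))
      * perm_expansion G (?V - L))"
  \<comment> \<open>Here F is \<open>perm_expansion G\<close>, B is the matching polynomial on
    induced subgraphs, and d counts long permutations.\<close>
  proof (rule set_convolution_inversion[where c = "signed_count (edges G)", OF fin])
    fix U assume U: "U \<subseteq> ?V"
    show "perm_expansion G U = (\<Sum>T\<in>Pow U. signed_count (edges G) T * ?B (U - T))"
      by (rule perm_expansion_conv_matching_poly[OF G U])
    show "(\<Sum>T\<in>Pow U. signed_count (edges G) T
        * of_nat (card (long_permutations (edges G) (U - T))))
      = (if U = {} then 1 else 0 :: real poly)"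
      by (rule signed_count_convolution[OF finite_subset[OF U fin]])
  qed
  also have "\<dots> = (\<Sum>L\<in>Pow ?V. (\<Sum>C\<in>two_regular_on G L. 2 ^ num_components C)
      * perm_expansion G (?V - L))"
    by (intro sum.cong refl) (simp add: card_long_permutations_conv_two_regular[OF G])
  also have "\<dots> = perm_expansion G (?V - {})
      + (\<Sum>C\<in>two_regular_subgraphs G. 2 ^ num_components C * perm_expansion G (?V - verts C))"
    by (rule sum_two_regular_on[OF G]) (rule empty)
  finally show "laplacian_matching_poly G = char_poly (signless_laplacian vs G)
      + (\<Sum>C\<in>two_regular_subgraphs G. 2 ^ num_components C
          * char_poly (principal_submatrix vs (signless_laplacian vs G) (verts G - verts C)))"
    by (simp add: char_poly_signless_laplacian[OF assms]
        char_poly_principal_submatrix[OF assms Diff_subset] B_V)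
qed

end
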